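(* Let $d\ge3$ and consider a $d$-dimensional random walk with internal states satisfying the basic assumptions (i)–(iv). Assume that $\varepsilon_0$ is distributed according to the unique stationary measure $\mu$. Then there are constants $\gamma_d,\beta_d$, depending on the random walk with internal states, such that as $n\to\infty$ $$E_3(n)=n\gamma_3+O(\sqrt n)\quad (d=3),$$ $$E_4(n)=n\gamma_4+O(\log n)\quad (d=4),$$ $$E_d(n)=n\gamma_d+\beta_d+O(n^{2-d/2})\quad\text{for } d\ge5.$$
   Context: Random walk with internal states (RWwIS). $E=\{1,\dots,s\}$ is a finite set, $d\ge1$, and $p_{y,j,k}\ge 0$ ($y\in\mathbb{Z}^d$, $j,k\in E$) satisfy $\sum_{y,k}p_{y,j,k}=1$ for each $j$. The RWwIS is the Markov chain $\xi_n=(\eta_n,\varepsilon_n)$ on $\mathbb{Z}^d\times E$ with $P(\xi_{n+1}=(x',k)\mid \xi_n=(x,j))=p_{x'-x,j,k}$; we start from $\eta_0=0$. Put $A_y=(p_{y,j,k})_{j,k}$, $Q=\sum_y A_y$, $M_l=\sum_y y_lA_y$, $\Sigma_{l,m}=\sum_y y_ly_mA_y$, $\underline{1}=(1,\dots,1)^T\in\mathbb{R}^s$. Basic assumptions: (i) the Markov chain $(\varepsilon_n)$ on $E$, whose transition matrix is $Q$, is irreducible and aperiodic; $\mu$ is its unique stationary distribution. (ii) Trivial arithmetic: for $j\in E$ the subgroup of $\mathbb{Z}^d$ generated by all differences $y-y'$ such that for some $n\geq 1$ both $P(\xi_n=(y,j)\mid\xi_0=(0,j))>0$ and $P(\xi_n=(y',j)\mid\xi_0=(0,j))>0$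 is $\mathbb{Z}^d$. (iii) Zero mean: $\langle\mu,M_l\underline{1}\rangle=0$ for all $l$. (iv) The second moments $\sum_y\|y\|^2A_y$ converge and the covariance matrix $\sigma=(\sigma_{l,m})_{1\le l,m\le d}$, $\sigma_{l,m}=\langle\mu,\Sigma_{l,m}\underline{1}\rangle-\langle\mu,M_l(Q-1)^{-1}M_m\underline{1}\rangle-\langle\mu,M_m(Q-1)^{-1}M_l\underline{1}\rangle$, is nonsingular (positive definite); here $(Q-1)^{-1}M_m\underline{1}$ is the unique vector $v$ with $\langle\mu,v\rangle=0$ and $Qv-v=M_m\underline{1}$. $L_d(n)=\#\{\eta_0,\dots,\eta_n\}$ is the number of distinct sites visited up to $n$ steps, and $E_d(n)$ is its expectation. *)

theory Defs
  imports
    "HOL-Probability.Probability"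
    "HOL-Computational_Algebra.Group_Closure"
    "HOL-Library.Landau_Symbols"
begin

text \<open>
  The lattice \<open>\<int>\<^sup>d\<close> is \<open>int ^ 'd\<close> with \<open>d = CARD('d)\<close>, and the finite set of internal states is the
  type \<open>'s\<close>. The weight \<open>p y j k\<close> is the probability of jumping by \<open>y\<close> while the internal
  state changes from \<open>j\<close> to \<open>k\<close>. Beware that \<open>*\<close>, \<open>^\<close> and \<open>1\<close> on type \<open>vec\<close> are componentwise, so \<open>1\<close>
  is the all-ones vector, while the matrix product is \<open>**\<close> and the identity matrix is \<open>mat 1\<close>.
\<close>

definition rw_weights :: "(int ^ 'd \<Rightarrow> 's::finite \<Rightarrow> 's \<Rightarrow> real) \<Rightarrow> bool" where
  "rw_weights p \<longleftrightarrow>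
     (\<forall>y j k. p y j k \<ge> 0) \<and> (\<forall>j. ((\<lambda>(y, k). p y j k) has_sum 1) UNIV)"


subsection \<open>Moment matrices\<close>

definition lat_vec :: "int ^ 'd \<Rightarrow> real ^ 'd" where
  "lat_vec y = (\<chi> l. real_of_int (y $ l))"

definition A_mat :: "(int ^ 'd \<Rightarrow> 's::finite \<Rightarrow> 's \<Rightarrow> real) \<Rightarrow> int ^ 'd \<Rightarrow> real ^ 's ^ 's" where
  "A_mat p y = (\<chi> j k. p y j k)"

definition Q_mat :: "(int ^ 'd \<Rightarrow> 's::finite \<Rightarrow> 's \<Rightarrow> real) \<Rightarrow> real ^ 's ^ 's" where
  "Q_mat p = (\<Sum>\<^sub>\<infinity>y. A_mat p y)"

definition M_mat :: "(int ^ 'd \<Rightarrow> 's::finite \<Rightarrow> 's \<Rightarrow> real) \<Rightarrow> 'd \<Rightarrow> real ^ 's ^ 's" where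
  "M_mat p l = (\<Sum>\<^sub>\<infinity>y. lat_vec y $ l *\<^sub>R A_mat p y)"

definition Sigma_mat :: "(int ^ 'd \<Rightarrow> 's::finite \<Rightarrow> 's \<Rightarrow> real) \<Rightarrow> 'd \<Rightarrow> 'd \<Rightarrow> real ^ 's ^ 's" where
  "Sigma_mat p l m = (\<Sum>\<^sub>\<infinity>y. (lat_vec y $ l * lat_vec y $ m) *\<^sub>R A_mat p y)"


subsection \<open>The chain of internal states\<close>

primrec mat_pow :: "real ^ 's ^ 's::finite \<Rightarrow> nat \<Rightarrow> real ^ 's ^ 's" where
  "mat_pow Q 0 = mat 1"
| "mat_pow Q (Suc n) = Q ** mat_pow Q n"

definition irreducible_mat :: "real ^ 's ^ 's::finite \<Rightarrow> bool" where
  "irreducible_mat Q \<longleftrightarrow> (\<forall>j k. \<exists>n. mat_pow Q n $ j $ k > 0)"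

definition aperiodic_mat :: "real ^ 's ^ 's::finite \<Rightarrow> bool" where
  "aperiodic_mat Q \<longleftrightarrow> (\<forall>j. Gcd {n. n \<ge> 1 \<and> mat_pow Q n $ j $ j > 0} = 1)"

definition stationary_distr :: "real ^ 's ^ 's::finite \<Rightarrow> real ^ 's \<Rightarrow> bool" where
  "stationary_distr Q \<mu> \<longleftrightarrow> (\<forall>j. \<mu> $ j \<ge> 0) \<and> (\<Sum>j\<in>UNIV. \<mu> $ j) = 1 \<and> \<mu> v* Q = \<mu>"


subsection \<open>Trivial arithmetic\<close>

text \<open>
  The entry \<open>(j, k)\<close> of \<open>nstep_mat p n y\<close> is the probability that the chain is in \<open>(y, k)\<close> at time \<open>n\<close>
  if it starts in \<open>(0, j)\<close>; the recursion conditions on the first jump.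
\<close>

primrec nstep_mat ::
  "(int ^ 'd \<Rightarrow> 's::finite \<Rightarrow> 's \<Rightarrow> real) \<Rightarrow> nat \<Rightarrow> int ^ 'd \<Rightarrow> real ^ 's ^ 's" where
  "nstep_mat p 0 = (\<lambda>y. if y = 0 then mat 1 else 0)"
| "nstep_mat p (Suc n) = (\<lambda>y. \<Sum>\<^sub>\<infinity>z. A_mat p z ** nstep_mat p n (y - z))"

definition trivial_arithmetic :: "(int ^ 'd \<Rightarrow> 's::finite \<Rightarrow> 's \<Rightarrow> real) \<Rightarrow> bool" where
  "trivial_arithmetic p \<longleftrightarrow>
     (\<forall>j. group_closure {y - y' | y y'.
            \<exists>n\<ge>1. nstep_mat p n y $ j $ j > 0 \<and> nstep_mat p n y' $ j $ j > 0} = UNIV)"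


subsection \<open>Mean and covariance\<close>

definition zero_mean :: "(int ^ 'd \<Rightarrow> 's::finite \<Rightarrow> 's \<Rightarrow> real) \<Rightarrow> real ^ 's \<Rightarrow> bool" where
  "zero_mean p \<mu> \<longleftrightarrow> (\<forall>l. \<mu> \<bullet> (M_mat p l *v 1) = 0)"

definition second_moments :: "(int ^ 'd \<Rightarrow> 's::finite \<Rightarrow> 's \<Rightarrow> real) \<Rightarrow> bool" where
  "second_moments p \<longleftrightarrow> (\<lambda>y. (norm (lat_vec y))\<^sup>2 *\<^sub>R A_mat p y) summable_on UNIV"

text \<open>
  \<open>Q - 1\<close> is singular; its inverse is taken on the vectors orthogonal to \<open>\<mu>\<close>. It is well defined on
  these if the chain is irreducible with stationary distribution \<open>\<mu>\<close>.
\<close>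

definition Q_minus_1_inv :: "real ^ 's ^ 's::finite \<Rightarrow> real ^ 's \<Rightarrow> real ^ 's \<Rightarrow> real ^ 's" where
  "Q_minus_1_inv Q \<mu> w = (THE v. \<mu> \<bullet> v = 0 \<and> Q *v v - v = w)"

definition covariance_mat ::
  "(int ^ 'd \<Rightarrow> 's::finite \<Rightarrow> 's \<Rightarrow> real) \<Rightarrow> real ^ 's \<Rightarrow> real ^ 'd ^ 'd" where
  "covariance_mat p \<mu> = (\<chi> l m.
     \<mu> \<bullet> (Sigma_mat p l m *v 1)
     - \<mu> \<bullet> (M_mat p l *v Q_minus_1_inv (Q_mat p) \<mu> (M_mat p m *v 1))
     - \<mu> \<bullet> (M_mat p m *v Q_minus_1_inv (Q_mat p) \<mu> (M_mat p l *v 1)))"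


subsection \<open>The process and its range\<close>

definition rwis_process ::
  "'w measure \<Rightarrow> (int ^ 'd \<Rightarrow> 's::finite \<Rightarrow> 's \<Rightarrow> real) \<Rightarrow> (nat \<Rightarrow> 'w \<Rightarrow> (int ^ 'd) \<times> 's) \<Rightarrow> bool" where
  "rwis_process M p \<xi> \<longleftrightarrow>
     prob_space M \<and>
     (\<forall>n. \<xi> n \<in> measurable M (count_space UNIV)) \<and>
     (AE \<omega> in M. fst (\<xi> 0 \<omega>) = 0) \<and>
     (\<forall>n w. \<P>(\<omega> in M. \<forall>i\<le>n. \<xi> i \<omega> = w i) > 0 \<longrightarrow>
        \<P>(\<omega> in M. \<xi> (Suc n) \<omega> = w (Suc n) \<bar> \<forall>i\<le>n. \<xi> i \<omega> = w i) =
          p (fst (w (Suc n)) - fst (w n)) (snd (w n)) (snd (w (Suc n))))"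

definition visited_sites :: "(nat \<Rightarrow> 'w \<Rightarrow> (int ^ 'd) \<times> 's::finite) \<Rightarrow> nat \<Rightarrow> 'w \<Rightarrow> nat" where
  "visited_sites \<xi> n \<omega> = card ((\<lambda>i. fst (\<xi> i \<omega>)) ` {..n})"

definition expected_visited ::
  "'w measure \<Rightarrow> (nat \<Rightarrow> 'w \<Rightarrow> (int ^ 'd) \<times> 's::finite) \<Rightarrow> nat \<Rightarrow> real" where
  "expected_visited M \<xi> n = (\<integral>\<omega>. real (visited_sites \<xi> n \<omega>) \<partial>M)"

end

theory Submission
imports Defs
begin

text \<open>
  The expected range is a sum of non-return probabilities. Of \<open>\<eta>\<^sub>0, \<dots>, \<eta>\<^sub>n\<close> count each site at its last
  visit: the site \<open>\<eta>\<^sub>i\<close> contributes if the walk avoids it at the times \<open>i + 1, \<dots>, n\<close>. Under the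
  stationary law the walk after time \<open>i\<close>, seen from \<open>\<eta>\<^sub>i\<close>, has the law of the walk itself, so
  \<open>E\<^sub>d(n) = h\<^sub>0 + \<dots> + h\<^sub>n\<close>, where \<open>h\<^sub>m\<close> is the probability of not returning to the starting site within
  \<open>m\<close> steps (\<open>stationary_mean_range\<close>). The sequence \<open>h\<close> decreases, and \<open>h\<^sub>m - h\<^sub>m\<^sub>+\<^sub>1\<close> is at most the probability
  of being at the starting site at time \<open>m + 1\<close> (\<open>no_return_Suc\<close>). If that probability is
  \<open>O(m\<^bsup>-d/2\<^esup>)\<close>, then \<open>h\<^sub>m\<close> tends to a limit \<open>\<gamma>\<close> with error \<open>O(m\<^bsup>1-d/2\<^esup>)\<close>, and summing this error gives
  \<open>O(\<surd>n)\<close>, \<open>O(log n)\<close>, or a convergent series with sum \<open>\<beta> - \<gamma>\<close> and tails \<open>O(n\<^bsup>2-d/2\<^esup>)\<close> (\<open>sum_asymptotics\<close>).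

  The point is therefore the bound \<open>P(\<eta>\<^sub>n = 0) = O(n\<^bsup>-d/2\<^esup>)\<close>, lemma \<open>return_probability_bound\<close>. For a
  character \<open>\<psi>\<close> of the lattice, the matrix with entries \<open>E(\<psi>(\<eta>\<^sub>n); \<epsilon>\<^sub>n = k | \<epsilon>\<^sub>0 = j)\<close> is the \<open>n\<close>-th power of the one
  for a single step. If two displacements \<open>y\<close>, \<open>y'\<close> are possible in a loop of \<open>n\<close> steps at the state \<open>j\<close>, then the
  phases \<open>\<psi>(y)\<close> and \<open>\<psi>(y')\<close> partly cancel, and the \<open>j\<close>-th row has norm at most \<open>1 - c |1 - \<psi>(y - y')|\<^sup>2\<close>.
  The set of all \<open>z\<close> that admit such a bound with \<open>z\<close> in place of \<open>y - y'\<close> is a subgroup; trivial arithmetic makes it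
  the whole lattice, so it contains the unit vectors \<open>e\<^sub>l\<close>. Hence for some \<open>N\<close> the norm
  after \<open>n\<close> steps is at most \<open>exp(-c (n div N) \<Sum>\<^sub>l |1 - \<psi>(e\<^sub>l)|\<^sup>2)\<close> (\<open>uniform_damping\<close>, \<open>damps_power\<close>).

  Instead of a Fourier integral over the torus, a finite average suffices for an upper bound: the
  \<open>K\<^sup>d\<close> characters \<open>y \<mapsto> exp(2\<pi>i t \<bullet> y / K)\<close> average to the indicator of \<open>K \<int>\<^sup>d\<close>, which dominates
  that of \<open>{0}\<close>. With \<open>K\<close> of order \<open>\<surd>n\<close> the averaged bound is
  \<open>K\<^bsup>-d\<^esup>\<close> times the \<open>d\<close>-th power of a bounded one-dimensional Gaussian sum.
\<close>

section \<open>Expectations over discrete distributions\<close>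

lemma pmf_integrable_bounded:
  fixes f :: "'a \<Rightarrow> 'b :: {banach, second_countable_topology}"
  assumes "\<And>x. x \<in> set_pmf q \<Longrightarrow> norm (f x) \<le> B"
  shows "integrable (measure_pmf q) f"
  using assms by (intro measure_pmf.integrable_const_bound[where B = B]) (auto simp: AE_measure_pmf_iff)

text \<open>
  A bound on the support is enough: truncating \<open>f\<close> at \<open>\<plusminus>B\<close> changes it only outside the support. The
  range of a walk is such an \<open>f\<close>, bounded by the number of steps but unbounded on all lists.
\<close>

lemma pmf_expectation_bind_bounded:
  fixes f :: "'a \<Rightarrow> real"
  assumes "\<And>y. y \<in> set_pmf (bind_pmf q N) \<Longrightarrow> \<bar>f y\<bar> \<le> B"
  shows "measure_pmf.expectation (bind_pmf q N) f =
    measure_pmf.expectation q (\<lambda>x. measure_pmf.expectation (N x) f)"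
proof -
  define f' where "f' y = max (- B) (min B (f y))" for y
  have f': "f y = f' y" if "y \<in> set_pmf (bind_pmf q N)" for y
    using assms[OF that] by (auto simp: f'_def abs_le_iff)
  have inner: "f' y = f y" if "x \<in> set_pmf q" "y \<in> set_pmf (N x)" for x y
  proof -
    have "y \<in> set_pmf (bind_pmf q N)" using that by auto
    from f'[OF this] show ?thesis ..
  qed
  have "B \<ge> 0" using assms set_pmf_not_empty[of "bind_pmf q N"] by fastforce
  then have bd: "\<bar>f' y\<bar> \<le> B" for y by (auto simp: f'_def)
  have "measure_pmf.expectation (bind_pmf q N) f = measure_pmf.expectation (bind_pmf q N) f'"
    using f' by (intro integral_cong_AE) (auto simp: AE_measure_pmf_iff)
  also have "\<dots> = measure_pmf.expectation q (\<lambda>x. measure_pmf.expectation (N x) f')"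
    unfolding measure_pmf_bind
    by (rule integral_bind[where K = "count_space UNIV" and B' = 1 and B = B])
       (auto simp: bd measure_pmf.emeasure_space_1 space_subprob_algebra measure_pmf.subprob_space_axioms
         intro!: measure_pmf.finite_measure_axioms)
  also have "\<dots> = measure_pmf.expectation q (\<lambda>x. measure_pmf.expectation (N x) f)"
    by (intro integral_cong_AE) (auto simp: AE_measure_pmf_iff intro!: integral_cong_AE inner)
  finally show ?thesis .
qed

lemma pmf_expectation_bind_complex:
  fixes f :: "'a \<Rightarrow> complex"
  assumes "\<And>x. norm (f x) \<le> B"
  shows "measure_pmf.expectation (bind_pmf q N) f =
    measure_pmf.expectation q (\<lambda>x. measure_pmf.expectation (N x) f)"
proof -
  have i: "integrable (measure_pmf r) f" for r :: "'a pmf"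
    by (rule pmf_integrable_bounded[where B = B]) (rule assms)
  have n: "norm (measure_pmf.expectation r f) \<le> B" for r :: "'a pmf"
  proof -
    have "norm (measure_pmf.expectation r f) \<le> measure_pmf.expectation r (\<lambda>x. norm (f x))"
      by (rule integral_norm_bound)
    also have "\<dots> \<le> B"
      by (rule measure_pmf.integral_le_const) (auto intro: i assms)
    finally show ?thesis .
  qed
  have i': "integrable (measure_pmf q) (\<lambda>x. measure_pmf.expectation (N x) f)"
    by (rule pmf_integrable_bounded[where B = B]) (rule n)
  have re: "\<bar>Re (f x)\<bar> \<le> B" "\<bar>Im (f x)\<bar> \<le> B" for x
    using abs_Re_le_cmod[of "f x"] abs_Im_le_cmod[of "f x"] assms[of x] by linarith+
  show ?thesis
    by (rule complex_eqI)
       (simp_all add: i i' pmf_expectation_bind_bounded[where B = B] re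
          flip: integral_Re integral_Im)
qed

lemma has_sum_vec:
  fixes f :: "'a \<Rightarrow> ('b::real_normed_vector) ^ 'n"
  assumes "\<And>i. ((\<lambda>x. f x $ i) has_sum s $ i) A"
  shows "(f has_sum s) A"
  using assms unfolding has_sum_def by (intro vec_tendstoI) (simp add: sum_component)

text \<open>
  Translates expectations into the infinite sums in which the convolutions of the weights are expressed.
\<close>

lemma pmf_expectation_has_sum:
  fixes f :: "'a \<Rightarrow> real"
  assumes "\<And>x. \<bar>f x\<bar> \<le> B"
  shows "((\<lambda>x. pmf q x * f x) has_sum measure_pmf.expectation q f) UNIV"
proof -
  have "integrable (measure_pmf q) f"
    using assms by (intro pmf_integrable_bounded[where B = B]) auto
  then have *: "Infinite_Set_Sum.abs_summable_on (\<lambda>x. pmf q x * f x) UNIV"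
    unfolding measure_pmf_eq_density Infinite_Set_Sum.abs_summable_on_def
    by (subst (asm) integrable_density) auto
  then have "(\<lambda>x. pmf q x * f x) summable_on UNIV"
    using abs_summable_equivalent abs_summable_summable by blast
  moreover have "infsum (\<lambda>x. pmf q x * f x) UNIV = measure_pmf.expectation q f"
    using infsetsum_infsum[OF *] by (simp add: pmf_expectation_eq_infsetsum)
  ultimately show ?thesis using has_sum_infsum by metis
qed

lemma has_sum_finite_fibres:
  fixes f :: "'a \<times> 'b::finite \<Rightarrow> real"
  assumes "(f has_sum v) UNIV"
  shows "((\<lambda>x. \<Sum>i\<in>UNIV. f (x, i)) has_sum v) UNIV"
proof (rule has_sum_SigmaD)
  show "(f has_sum v) (UNIV \<times> UNIV)" using assms by simp
  show "((\<lambda>i. f (x, i)) has_sum (\<Sum>i\<in>UNIV. f (x, i))) UNIV" for x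
    by (rule has_sum_finite) simp
qed

section \<open>The walk and its range\<close>

text \<open>
  A kernel \<open>\<kappa>\<close> gives, for each internal state, the joint law of the displacement and the next
  internal state; positions may lie in any abelian group.
\<close>

definition jump_step :: "('s \<Rightarrow> ('g::ab_group_add \<times> 's) pmf) \<Rightarrow> 'g \<times> 's \<Rightarrow> ('g \<times> 's) pmf" where
  "jump_step \<kappa> s = map_pmf (apfst ((+) (fst s))) (\<kappa> (snd s))"

primrec state_at :: "('s \<Rightarrow> ('g::ab_group_add \<times> 's) pmf) \<Rightarrow> nat \<Rightarrow> 'g \<times> 's \<Rightarrow> ('g \<times> 's) pmf" where
  "state_at \<kappa> 0 s = return_pmf s"
| "state_at \<kappa> (Suc n) s = bind_pmf (jump_step \<kappa> s) (state_at \<kappa> n)"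

text \<open>
  The states at the times \<open>1, \<dots>, n\<close>; the initial state is left out, so that a return to its site is
  visible as membership in the list.
\<close>

primrec future :: "('s \<Rightarrow> ('g::ab_group_add \<times> 's) pmf) \<Rightarrow> nat \<Rightarrow> 'g \<times> 's \<Rightarrow> ('g \<times> 's) list pmf" where
  "future \<kappa> 0 s = return_pmf []"
| "future \<kappa> (Suc n) s = bind_pmf (jump_step \<kappa> s) (\<lambda>s'. map_pmf ((#) s') (future \<kappa> n s'))"

lemma jump_step_origin: "jump_step \<kappa> (0, j) = \<kappa> j"
proof -
  have "apfst ((+) 0) = (id :: 'a \<times> 'b \<Rightarrow> _)" by (auto simp: fun_eq_iff)
  then show ?thesis by (simp add: jump_step_def)
qed

lemma jump_step_translate:
  "jump_step \<kappa> (apfst ((+) x) s) = map_pmf (apfst ((+) x)) (jump_step \<kappa> s)"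
  by (cases s) (auto simp: jump_step_def pmf.map_comp o_def apfst_def map_prod_def add.assoc case_prod_unfold)

lemma state_at_translate:
  "state_at \<kappa> n (apfst ((+) x) s) = map_pmf (apfst ((+) x)) (state_at \<kappa> n s)"
  by (induction n arbitrary: s) (simp_all add: jump_step_translate bind_map_pmf map_bind_pmf)

lemma state_at_translate_origin:
  "state_at \<kappa> n (x, j) = map_pmf (apfst ((+) x)) (state_at \<kappa> n (0, j))"
  using state_at_translate[of \<kappa> n x "(0, j)"] by simp

lemma state_at_add:
  "state_at \<kappa> (m + n) s = bind_pmf (state_at \<kappa> m s) (state_at \<kappa> n)"
  by (induction m arbitrary: s) (simp_all add: bind_return_pmf bind_assoc_pmf cong: bind_pmf_cong)

lemma future_translate:
  "future \<kappa> n (apfst ((+) x) s) = map_pmf (map (apfst ((+) x))) (future \<kappa> n s)"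
  by (induction n arbitrary: s)
     (simp_all add: jump_step_translate bind_map_pmf map_bind_pmf pmf.map_comp o_def)

text \<open>
  \<open>future\<close> unfolds at the first step, which is the form used for the range. The law of a process and the
  effect of a longer time horizon need the last step instead.
\<close>

lemma future_snoc:
  "future \<kappa> (Suc n) s =
     bind_pmf (future \<kappa> n s) (\<lambda>w. map_pmf (\<lambda>s'. w @ [s']) (jump_step \<kappa> (last (s # w))))"
proof (induction n arbitrary: s)
  case 0
  then show ?case by (simp add: bind_return_pmf map_pmf_def)
next
  case (Suc n)
  show ?case
    by (subst future.simps(2), subst Suc.IH)
       (simp add: map_bind_pmf bind_assoc_pmf bind_map_pmf pmf.map_comp o_def)
qed

lemma map_last_future: "map_pmf (\<lambda>w. last (s # w)) (future \<kappa> n s) = state_at \<kappa> n s"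
proof (induction n arbitrary: s)
  case (Suc n)
  have "map_pmf (\<lambda>w. last (s # w)) (future \<kappa> (Suc n) s) =
    bind_pmf (jump_step \<kappa> s) (\<lambda>s'. map_pmf (\<lambda>w. last (s' # w)) (future \<kappa> n s'))"
    by (simp add: map_bind_pmf pmf.map_comp o_def del: last.simps) (simp add: last.simps)
  then show ?case using Suc.IH by simp
qed simp

lemma length_future: "w \<in> set_pmf (future \<kappa> n s) \<Longrightarrow> length w = n"
  by (induction n arbitrary: s w) auto

definition sites :: "('g \<times> 's) list \<Rightarrow> 'g set" where
  "sites w = fst ` set w"

definition no_return :: "('s \<Rightarrow> ('g::ab_group_add \<times> 's) pmf) \<Rightarrow> nat \<Rightarrow> 's \<Rightarrow> real" where
  "no_return \<kappa> n j = measure_pmf.prob (future \<kappa> n (0, j)) {w. 0 \<notin> sites w}"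

definition mean_range :: "('s \<Rightarrow> ('g::ab_group_add \<times> 's) pmf) \<Rightarrow> nat \<Rightarrow> 'g \<times> 's \<Rightarrow> real" where
  "mean_range \<kappa> n s = measure_pmf.expectation (future \<kappa> n s) (\<lambda>w. real (card (sites (s # w))))"

lemma mean_range_translate:
  fixes \<kappa> :: "'s \<Rightarrow> ('g::ab_group_add \<times> 's) pmf"
  shows "mean_range \<kappa> n (apfst ((+) x) s) = mean_range \<kappa> n s"
proof -
  have "sites (apfst ((+) x) s # map (apfst ((+) x)) w) = (+) x ` sites (s # w)" for w :: "('g \<times> 's) list"
    by (simp add: sites_def image_image)
  then have "card (sites (apfst ((+) x) s # map (apfst ((+) x)) w)) = card (sites (s # w))"
    for w :: "('g \<times> 's) list"
    by (simp add: card_image)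
  then show ?thesis by (simp add: mean_range_def future_translate)
qed

lemma mean_range_origin: "mean_range \<kappa> n (x, j) = mean_range \<kappa> n (0, j)"
  using mean_range_translate[of \<kappa> n x "(0, j)"] by simp

lemma card_sites_le: "card (sites w) \<le> length w"
  unfolding sites_def by (rule order_trans[OF card_image_le card_length]) auto

lemma integrable_card_sites:
  "integrable (measure_pmf (future \<kappa> n s)) (\<lambda>w. real (card (sites (v @ w))))"
proof (rule pmf_integrable_bounded)
  fix w assume "w \<in> set_pmf (future \<kappa> n s)"
  from length_future[OF this] show "norm (real (card (sites (v @ w)))) \<le> real (length v + n)"
    using card_sites_le[of "v @ w"] by simp
qed

lemma mean_range_bounds: "mean_range \<kappa> n s \<in> {0..real (Suc n)}"
proof -
  have "mean_range \<kappa> n s \<le> real (Suc n)"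
    unfolding mean_range_def
  proof (rule measure_pmf.integral_le_const)
    show "integrable (measure_pmf (future \<kappa> n s)) (\<lambda>w. real (card (sites (s # w))))"
      using integrable_card_sites[of \<kappa> n s "[s]"] by simp
    show "AE w in measure_pmf (future \<kappa> n s). real (card (sites (s # w))) \<le> real (Suc n)"
    proof (unfold AE_measure_pmf_iff, intro ballI)
      fix w assume "w \<in> set_pmf (future \<kappa> n s)"
      then show "real (card (sites (s # w))) \<le> real (Suc n)"
        using card_sites_le[of "s # w"] by (simp add: length_future)
    qed
  qed
  then show ?thesis by (simp add: mean_range_def)
qed

text \<open>
  The initial site adds one to the number of sites seen from time \<open>1\<close> on exactly if it is never revisited;
  by translation invariance only the internal state at time \<open>1\<close> matters for the remaining sites.
\<close>

lemma mean_range_Suc: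
  fixes \<kappa> :: "'s \<Rightarrow> ('g::ab_group_add \<times> 's) pmf"
  shows "mean_range \<kappa> (Suc n) (0, j) =
     measure_pmf.expectation (\<kappa> j) (\<lambda>(y, k). mean_range \<kappa> n (0, k)) + no_return \<kappa> (Suc n) j"
proof -
  let ?F = "future \<kappa> (Suc n) (0, j)"
  have split: "real (card (sites ((0, j) # w))) = real (card (sites w)) + indicator {w. 0 \<notin> sites w} w"
    for w :: "('g \<times> 's) list"
    by (auto simp: sites_def card_insert_if)
  have "mean_range \<kappa> (Suc n) (0, j) =
    measure_pmf.expectation ?F (\<lambda>w. real (card (sites w))) + no_return \<kappa> (Suc n) j"
    unfolding mean_range_def split no_return_def
  proof (subst Bochner_Integration.integral_add)
    show "integrable ?F (\<lambda>w. real (card (sites w)))"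
      using integrable_card_sites[of \<kappa> "Suc n" "(0, j)" "[]"] by simp
    show "integrable ?F (indicator {w. 0 \<notin> sites w} :: _ \<Rightarrow> real)"
      by (rule pmf_integrable_bounded[where B = 1]) (simp add: indicator_def)
  qed simp
  also have "measure_pmf.expectation ?F (\<lambda>w. real (card (sites w))) =
    measure_pmf.expectation (jump_step \<kappa> (0, j)) (mean_range \<kappa> n)"
  proof -
    have "\<bar>real (card (sites w))\<bar> \<le> real (Suc n)" if "w \<in> set_pmf ?F" for w
      using card_sites_le[of w] length_future[OF that] by simp
    then show ?thesis
      unfolding future.simps by (subst pmf_expectation_bind_bounded) (auto simp: mean_range_def[abs_def])
  qed
  also have "\<dots> = measure_pmf.expectation (\<kappa> j) (\<lambda>(y, k). mean_range \<kappa> n (0, k))"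
    unfolding jump_step_def integral_map_pmf
    by (intro Bochner_Integration.integral_cong) (auto intro: mean_range_origin)
  finally show ?thesis .
qed

lemma mean_range_0: "mean_range \<kappa> 0 s = 1"
  by (simp add: mean_range_def sites_def)

lemma no_return_0: "no_return \<kappa> 0 j = 1"
  by (simp add: no_return_def sites_def)

text \<open>
  A walk that avoids its initial site up to time \<open>n\<close> but not up to time \<open>n + 1\<close> is there at time \<open>n + 1\<close>.
\<close>

lemma no_return_Suc:
  fixes \<kappa> :: "'s \<Rightarrow> ('g::ab_group_add \<times> 's) pmf"
  shows "no_return \<kappa> (Suc n) j \<le> no_return \<kappa> n j"
  "no_return \<kappa> n j - no_return \<kappa> (Suc n) j \<le> measure_pmf.prob (state_at \<kappa> (Suc n) (0, j)) ({0} \<times> UNIV)"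
proof -
  let ?F = "future \<kappa> (Suc n) (0, j)"
  have butlast: "map_pmf butlast ?F = future \<kappa> n (0, j)"
    by (subst future_snoc) (simp add: map_bind_pmf pmf.map_comp o_def bind_return_pmf')
  have A: "no_return \<kappa> n j = measure_pmf.prob ?F {w. 0 \<notin> sites (butlast w)}"
    unfolding no_return_def by (subst butlast[symmetric]) (simp add: vimage_def)
  have sub: "sites (butlast w) \<subseteq> sites w" for w :: "('g \<times> 's) list"
    by (auto simp: sites_def dest: in_set_butlastD)
  show "no_return \<kappa> (Suc n) j \<le> no_return \<kappa> n j"
    unfolding A unfolding no_return_def by (intro measure_pmf.finite_measure_mono) (auto dest!: subsetD[OF sub])
  have B: "measure_pmf.prob (state_at \<kappa> (Suc n) (0, j)) ({0} \<times> UNIV) =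
    measure_pmf.prob ?F {w. fst (last ((0, j) # w)) = 0}"
    by (subst map_last_future[symmetric]) (simp add: vimage_def mem_Times_iff)
  have "no_return \<kappa> n j \<le> no_return \<kappa> (Suc n) j + measure_pmf.prob ?F {w. fst (last ((0, j) # w)) = 0}"
  proof -
    have *: "0 \<in> sites w \<Longrightarrow> 0 \<notin> sites (butlast w) \<Longrightarrow> fst (last ((0, j) # w)) = 0"
      for w :: "('g \<times> 's) list"
      by (cases w rule: rev_cases) (auto simp: sites_def)
    have "no_return \<kappa> n j \<le> measure_pmf.prob ?F ({w. 0 \<notin> sites w} \<union> {w. fst (last ((0, j) # w)) = 0})"
      unfolding A by (rule measure_pmf.finite_measure_mono) (use * in blast, simp)
    also have "\<dots> \<le> measure_pmf.prob ?F {w. 0 \<notin> sites w} + measure_pmf.prob ?F {w. fst (last ((0, j) # w)) = 0}"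
      by (rule measure_Un_le) auto
    finally show ?thesis by (simp add: no_return_def)
  qed
  then show "no_return \<kappa> n j - no_return \<kappa> (Suc n) j \<le> measure_pmf.prob (state_at \<kappa> (Suc n) (0, j)) ({0} \<times> UNIV)"
    unfolding B by simp
qed

text \<open>
  Stationarity makes the recursion for the mean range telescope: after the first step the internal state
  again has the law \<open>\<pi>\<close>.
\<close>

lemma stationary_mean_range:
  fixes \<pi> :: "'s pmf" and \<kappa> :: "'s \<Rightarrow> ('g::ab_group_add \<times> 's) pmf"
  assumes stat: "bind_pmf \<pi> (\<lambda>j. map_pmf snd (\<kappa> j)) = \<pi>"
  shows "measure_pmf.expectation \<pi> (\<lambda>j. mean_range \<kappa> n (0, j)) =
    (\<Sum>m\<le>n. measure_pmf.expectation \<pi> (no_return \<kappa> m))"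
proof (induction n)
  case 0
  then show ?case by (simp add: mean_range_0 no_return_0)
next
  case (Suc n)
  let ?f = "\<lambda>k. mean_range \<kappa> n (0, k)"
  have bd: "\<bar>?f k\<bar> \<le> real (Suc n)" for k
    using mean_range_bounds[of \<kappa> n "(0, k)"] by auto
  have "measure_pmf.expectation \<pi> (\<lambda>j. mean_range \<kappa> (Suc n) (0, j)) =
    measure_pmf.expectation \<pi> (\<lambda>j. measure_pmf.expectation (map_pmf snd (\<kappa> j)) ?f)
    + measure_pmf.expectation \<pi> (no_return \<kappa> (Suc n))"
    unfolding mean_range_Suc
  proof (subst Bochner_Integration.integral_add)
    show "integrable \<pi> (\<lambda>j. measure_pmf.expectation (\<kappa> j) (\<lambda>(y, k). mean_range \<kappa> n (0, k)))"
    proof (rule pmf_integrable_bounded)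
      fix j
      have "norm (measure_pmf.expectation (\<kappa> j) (\<lambda>(y, k). ?f k)) \<le>
        measure_pmf.expectation (\<kappa> j) (\<lambda>s. norm (case s of (y, k) \<Rightarrow> ?f k))"
        by (rule integral_norm_bound)
      also have "\<dots> \<le> real (Suc n)"
        by (rule measure_pmf.integral_le_const) (use bd in \<open>auto intro!: pmf_integrable_bounded\<close>)
      finally show "norm (measure_pmf.expectation (\<kappa> j) (\<lambda>(y, k). ?f k)) \<le> real (Suc n)" .
    qed
    show "integrable \<pi> (no_return \<kappa> (Suc n))"
      by (rule pmf_integrable_bounded[where B = 1]) (simp add: no_return_def)
  qed (simp add: case_prod_unfold)
  also have "measure_pmf.expectation \<pi> (\<lambda>j. measure_pmf.expectation (map_pmf snd (\<kappa> j)) ?f) =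
    measure_pmf.expectation (bind_pmf \<pi> (\<lambda>j. map_pmf snd (\<kappa> j))) ?f"
    by (rule pmf_expectation_bind_bounded[symmetric]) (rule bd)
  finally show ?case by (simp add: stat Suc.IH)
qed

text \<open>
  Unlike \<open>future\<close>, these lists include the initial state, at the site \<open>0\<close> with internal law \<open>\<pi>\<close>.
\<close>

definition walk_law :: "('s \<Rightarrow> ('g::ab_group_add \<times> 's) pmf) \<Rightarrow> 's pmf \<Rightarrow> nat \<Rightarrow> ('g \<times> 's) list pmf" where
  "walk_law \<kappa> \<pi> n = bind_pmf \<pi> (\<lambda>j. map_pmf ((#) (0, j)) (future \<kappa> n (0, j)))"

lemma length_walk_law: "w \<in> set_pmf (walk_law \<kappa> \<pi> n) \<Longrightarrow> length w = Suc n"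
  by (auto simp: walk_law_def dest: length_future)

lemma walk_law_Suc:
  "walk_law \<kappa> \<pi> (Suc n) = bind_pmf (walk_law \<kappa> \<pi> n) (\<lambda>w. map_pmf (\<lambda>s. w @ [s]) (jump_step \<kappa> (last w)))"
  unfolding walk_law_def future_snoc
  by (simp add: map_bind_pmf bind_assoc_pmf bind_map_pmf pmf.map_comp o_def del: future.simps)

lemma pmf_walk_law_snoc:
  "pmf (walk_law \<kappa> \<pi> (Suc n)) (w @ [s]) = pmf (walk_law \<kappa> \<pi> n) w * pmf (jump_step \<kappa> (last w)) s"
proof -
  have "pmf (map_pmf (\<lambda>s. v @ [s]) (jump_step \<kappa> (last v))) (w @ [s]) =
    indicator {w} v * pmf (jump_step \<kappa> (last w)) s" for v
  proof (cases "v = w")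
    case True
    have "inj (\<lambda>s. w @ [s])" by (simp add: inj_def)
    from pmf_map_inj'[OF this] show ?thesis using True by simp
  next
    case False
    then show ?thesis by (auto simp: pmf_eq_0_set_pmf)
  qed
  then show ?thesis by (simp add: walk_law_Suc pmf_bind measure_pmf_single)
qed

lemma mean_card_sites_walk_law:
  "measure_pmf.expectation (walk_law \<kappa> \<pi> n) (\<lambda>w. real (card (sites w))) =
     measure_pmf.expectation \<pi> (\<lambda>j. mean_range \<kappa> n (0, j))"
proof -
  have "\<bar>real (card (sites w))\<bar> \<le> real (Suc n)" if "w \<in> set_pmf (walk_law \<kappa> \<pi> n)" for w
    using card_sites_le[of w] length_walk_law[OF that] by simp
  then show ?thesis
    unfolding walk_law_def by (subst pmf_expectation_bind_bounded) (auto simp: mean_range_def)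
qed

section \<open>Damping of characters\<close>

definition character :: "('g::ab_group_add \<Rightarrow> complex) \<Rightarrow> bool" where
  "character \<psi> \<longleftrightarrow> (\<forall>x y. \<psi> (x + y) = \<psi> x * \<psi> y) \<and> (\<forall>x. norm (\<psi> x) = 1)"

lemma character_add: "character \<psi> \<Longrightarrow> \<psi> (x + y) = \<psi> x * \<psi> y"
  and norm_character: "character \<psi> \<Longrightarrow> norm (\<psi> x) = 1"
  by (auto simp: character_def)

lemma norm_character_diff:
  assumes "character \<psi>"
  shows "norm (\<psi> y - \<psi> y') = norm (1 - \<psi> (y - y'))"
proof -
  have "\<psi> y - \<psi> y' = \<psi> y' * (\<psi> (y - y') - 1)"
    using character_add[OF assms, of y' "y - y'"] by (simp add: algebra_simps)
  then show ?thesis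
    using norm_character[OF assms, of y'] by (simp add: norm_mult norm_minus_commute)
qed

text \<open>
  The \<open>n\<close>-th power of the Fourier transform of the kernel at \<open>\<psi>\<close>, a matrix over the internal states,
  applied to the vector \<open>g\<close>.
\<close>

definition char_op :: "('s \<Rightarrow> ('g::ab_group_add \<times> 's) pmf) \<Rightarrow> nat \<Rightarrow> ('g \<Rightarrow> complex) \<Rightarrow> ('s \<Rightarrow> complex) \<Rightarrow> 's \<Rightarrow> complex" where
  "char_op \<kappa> n \<psi> g j = measure_pmf.expectation (state_at \<kappa> n (0, j)) (\<lambda>s. \<psi> (fst s) * g (snd s))"

lemma norm_char_op_le:
  assumes "character \<psi>" and "\<And>k. norm (g k) \<le> B"
  shows "norm (char_op \<kappa> n \<psi> g j) \<le> B"
proof -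
  have b: "norm (\<psi> (fst s) * g (snd s)) \<le> B" for s
    using assms by (simp add: norm_mult norm_character)
  have "norm (char_op \<kappa> n \<psi> g j) \<le>
      measure_pmf.expectation (state_at \<kappa> n (0, j)) (\<lambda>s. norm (\<psi> (fst s) * g (snd s)))"
    unfolding char_op_def by (rule integral_norm_bound)
  also have "\<dots> \<le> B"
    by (rule measure_pmf.integral_le_const) (use b in \<open>auto intro!: pmf_integrable_bounded\<close>)
  finally show ?thesis .
qed

text \<open>
  By translation invariance, the walk started at \<open>x\<close> only picks up the factor \<open>\<psi> x\<close>; the Markov property
  then composes the operators.
\<close>

lemma char_op_add:
  assumes "character \<psi>" and "\<And>k. norm (g k) \<le> B"
  shows "char_op \<kappa> (m + n) \<psi> g j = char_op \<kappa> m \<psi> (char_op \<kappa> n \<psi> g) j"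
proof -
  have b: "norm (\<psi> (fst s) * g (snd s)) \<le> B" for s
    using assms by (simp add: norm_mult norm_character)
  have inner: "measure_pmf.expectation (state_at \<kappa> n s) (\<lambda>s. \<psi> (fst s) * g (snd s)) =
    \<psi> (fst s) * char_op \<kappa> n \<psi> g (snd s)" for s
    using state_at_translate_origin[of \<kappa> n "fst s" "snd s"]
    by (simp add: char_op_def character_add[OF assms(1)] mult.assoc)
  show ?thesis
    unfolding char_op_def[of _ "m + n"] char_op_def[of _ m] state_at_add pmf_expectation_bind_complex[OF b]
      inner ..
qed

text \<open>
  The \<open>j\<close>-th row of the Fourier transform after \<open>n\<close> steps has \<open>\<ell>\<^sup>1\<close>-norm at most \<open>r\<close>. Testing against all \<open>g\<close>
  and scaling by \<open>B\<close> lets the bound be iterated.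
\<close>

definition damps :: "('s \<Rightarrow> ('g::ab_group_add \<times> 's) pmf) \<Rightarrow> nat \<Rightarrow> ('g \<Rightarrow> complex) \<Rightarrow> 's \<Rightarrow> real \<Rightarrow> bool" where
  "damps \<kappa> n \<psi> j r \<longleftrightarrow> (\<forall>g B. (\<forall>k. norm (g k) \<le> B) \<longrightarrow> norm (char_op \<kappa> n \<psi> g j) \<le> r * B)"

lemma dampsD: "damps \<kappa> n \<psi> j r \<Longrightarrow> (\<And>k. norm (g k) \<le> B) \<Longrightarrow> norm (char_op \<kappa> n \<psi> g j) \<le> r * B"
  by (auto simp: damps_def)

text \<open>
  Rows of later powers are no longer, because the operators are contractions in the supremum norm. So
  bounds obtained at different times can be used at one common time.
\<close>

lemma damps_later:
  fixes \<kappa> :: "'s \<Rightarrow> ('g::ab_group_add \<times> 's) pmf"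
  assumes "character \<psi>" "damps \<kappa> n \<psi> j r" "n \<le> n'"
  shows "damps \<kappa> n' \<psi> j r"
  unfolding damps_def
proof (intro allI impI)
  fix g B assume g: "\<forall>k::'s. norm (g k :: complex) \<le> B"
  obtain m where n': "n' = n + m" using assms(3) le_Suc_ex by blast
  have "norm (char_op \<kappa> m \<psi> g k) \<le> B" for k
    using assms(1) g by (intro norm_char_op_le) auto
  then have "norm (char_op \<kappa> n \<psi> (char_op \<kappa> m \<psi> g) j) \<le> r * B"
    by (rule dampsD[OF assms(2)])
  then show "norm (char_op \<kappa> n' \<psi> g j) \<le> r * B"
    unfolding n' using g by (subst char_op_add[OF assms(1), of g B]) simp_all
qed

lemma damps_mono:
  fixes \<kappa> :: "'s \<Rightarrow> ('g::ab_group_add \<times> 's) pmf"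
  assumes "damps \<kappa> n \<psi> j r" "r \<le> r'"
  shows "damps \<kappa> n \<psi> j r'"
  unfolding damps_def
proof (intro allI impI)
  fix g B assume g: "\<forall>k::'s. norm (g k :: complex) \<le> B"
  have "norm (g j) \<le> B" using g by blast
  then have "B \<ge> 0" using norm_ge_zero[of "g j"] by linarith
  then have "r * B \<le> r' * B" using assms(2) by (rule mult_right_mono[rotated])
  moreover have "norm (char_op \<kappa> n \<psi> g j) \<le> r * B" using assms(1) g by (auto intro: dampsD)
  ultimately show "norm (char_op \<kappa> n \<psi> g j) \<le> r' * B" by linarith
qed

text \<open>
  From the parallelogram law and \<open>sqrt (4 - u) \<le> 2 - u / 4\<close>.
\<close>

lemma norm_add_unit_le:
  fixes w w' :: complex
  assumes "norm w = 1" "norm w' = 1"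
  shows "norm (w + w') \<le> 2 - (norm (w - w'))\<^sup>2 / 4"
proof (rule power2_le_imp_le)
  have "(norm (w + w'))\<^sup>2 + (norm (w - w'))\<^sup>2 = 2 * (norm w)\<^sup>2 + 2 * (norm w')\<^sup>2"
    unfolding cmod_power2 by (simp add: power2_eq_square algebra_simps)
  then have *: "(norm (w + w'))\<^sup>2 = 4 - (norm (w - w'))\<^sup>2" using assms by simp
  also have "\<dots> \<le> (2 - (norm (w - w'))\<^sup>2 / 4)\<^sup>2"
    by (simp add: power2_eq_square algebra_simps)
  finally show "(norm (w + w'))\<^sup>2 \<le> (2 - (norm (w - w'))\<^sup>2 / 4)\<^sup>2" .
  have "(norm (w - w'))\<^sup>2 \<le> 4" using * zero_le_power2[of "norm (w + w')"] by linarith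
  then show "0 \<le> 2 - (norm (w - w'))\<^sup>2 / 4" by simp
qed

text \<open>
  Split off mass \<open>\<delta>\<close> from each of the two points. Both carry the same value \<open>g j\<close>, so their
  contributions partly cancel when the phases \<open>\<psi> y\<close> and \<open>\<psi> y'\<close> differ; the rest is bounded by its mass.
\<close>

lemma damps_two_points:
  fixes \<kappa> :: "'s \<Rightarrow> ('g::ab_group_add \<times> 's) pmf"
  assumes \<psi>: "character \<psi>" and "0 \<le> \<delta>"
    and "\<delta> \<le> pmf (state_at \<kappa> n (0, j)) (y, j)" and "\<delta> \<le> pmf (state_at \<kappa> n (0, j)) (y', j)"
  shows "damps \<kappa> n \<psi> j (1 - \<delta> / 4 * (norm (1 - \<psi> (y - y')))\<^sup>2)"
proof (cases "y = y'")
  case True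
  have "\<psi> 0 = 1"
    using character_add[OF \<psi>, of 0 0] norm_character[OF \<psi>, of 0] by auto
  then show ?thesis
    using True by (auto simp: damps_def intro: norm_char_op_le[OF \<psi>])
next
  case False
  let ?q = "state_at \<kappa> n (0, j)"
  define S where "S = {(y, j), (y', j)}"
  define a b where "a = pmf ?q (y, j)" and "b = pmf ?q (y', j)"
  have ab: "\<delta> \<le> a" "\<delta> \<le> b" using assms by (auto simp: a_def b_def)
  show ?thesis
    unfolding damps_def
  proof (intro allI impI)
    fix g B assume g: "\<forall>k::'s. norm (g k :: complex) \<le> B"
    have "norm (g j) \<le> B" using g by blast
    then have B: "B \<ge> 0" using norm_ge_zero[of "g j"] by linarith
    define f where "f = (\<lambda>s. \<psi> (fst s) * g (snd s))"
    have f: "norm (f s) \<le> B" for s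
      using g by (simp add: f_def norm_mult norm_character[OF \<psi>])
    have int: "integrable (measure_pmf ?q) (\<lambda>s. indicator T s *\<^sub>R f s)" for T
      by (rule pmf_integrable_bounded[where B = B])
         (use f B in \<open>auto simp: indicator_def\<close>)
    have "char_op \<kappa> n \<psi> g j = measure_pmf.expectation ?q (\<lambda>s. indicator S s *\<^sub>R f s + indicator (- S) s *\<^sub>R f s)"
      unfolding char_op_def f_def by (intro Bochner_Integration.integral_cong) (auto simp: indicator_def)
    also have "\<dots> = measure_pmf.expectation ?q (\<lambda>s. indicator S s *\<^sub>R f s)
        + measure_pmf.expectation ?q (\<lambda>s. indicator (- S) s *\<^sub>R f s)"
      by (rule Bochner_Integration.integral_add[OF int int])
    also have "measure_pmf.expectation ?q (\<lambda>s. indicator S s *\<^sub>R f s) = (\<Sum>s\<in>S. pmf ?q s *\<^sub>R f s)"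
      by (subst integral_measure_pmf[of S]) (auto simp: S_def indicator_def split: if_splits)
    also have "\<dots> = (a * \<psi> y + b * \<psi> y') * g j"
      using False by (simp add: S_def a_def b_def f_def scaleR_conv_of_real algebra_simps)
    finally have "norm (char_op \<kappa> n \<psi> g j) \<le> norm (a * \<psi> y + b * \<psi> y') * norm (g j)
        + norm (measure_pmf.expectation ?q (\<lambda>s. indicator (- S) s *\<^sub>R f s))"
      using norm_triangle_ineq by (metis norm_mult)
    also have "norm (measure_pmf.expectation ?q (\<lambda>s. indicator (- S) s *\<^sub>R f s)) \<le> (1 - (a + b)) * B"
    proof -
      have "norm (measure_pmf.expectation ?q (\<lambda>s. indicator (- S) s *\<^sub>R f s)) \<le>
          measure_pmf.expectation ?q (\<lambda>s. norm (indicator (- S) s *\<^sub>R f s))"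
        by (rule integral_norm_bound)
      also have "\<dots> \<le> measure_pmf.expectation ?q (\<lambda>s. indicator (- S) s * B)"
        by (intro integral_mono integrable_norm int pmf_integrable_bounded[where B = B])
           (use f B in \<open>auto simp: indicator_def\<close>)
      also have "\<dots> = measure_pmf.prob ?q (- S) * B" by simp
      also have "measure_pmf.prob ?q (- S) = 1 - measure_pmf.prob ?q S"
        using measure_pmf.prob_compl[of S ?q] by (simp add: Compl_eq_Diff_UNIV)
      also have "measure_pmf.prob ?q S = a + b"
        using False by (subst measure_measure_pmf_finite) (auto simp: S_def a_def b_def)
      finally show ?thesis .
    qed
    also have "norm (a * \<psi> y + b * \<psi> y') * norm (g j) \<le> (a + b - \<delta> / 4 * (norm (1 - \<psi> (y - y')))\<^sup>2) * B"
    proof (rule mult_mono)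
      \<comment> \<open>Only the common mass \<open>\<delta>\<close> is used for cancellation.\<close>
      have "a * \<psi> y + b * \<psi> y' = (a - \<delta>) * \<psi> y + (b - \<delta>) * \<psi> y' + \<delta> * (\<psi> y + \<psi> y')"
        by (simp add: algebra_simps)
      also have "norm \<dots> \<le> norm ((a - \<delta>) * \<psi> y) + norm ((b - \<delta>) * \<psi> y') + norm (\<delta> * (\<psi> y + \<psi> y'))"
        by (intro norm_triangle_mono order_refl)
      also have "\<dots> = (a - \<delta>) + (b - \<delta>) + \<delta> * norm (\<psi> y + \<psi> y')"
        using ab \<open>0 \<le> \<delta>\<close>
        by (simp add: norm_mult norm_character[OF \<psi>] flip: of_real_diff)
      also have "\<delta> * norm (\<psi> y + \<psi> y') \<le> \<delta> * (2 - (norm (\<psi> y - \<psi> y'))\<^sup>2 / 4)"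
        by (intro mult_left_mono norm_add_unit_le norm_character \<psi> \<open>0 \<le> \<delta>\<close>)
      finally show *: "norm (a * \<psi> y + b * \<psi> y') \<le> a + b - \<delta> / 4 * (norm (1 - \<psi> (y - y')))\<^sup>2"
        by (simp add: norm_character_diff[OF \<psi>] algebra_simps)
      from order_trans[OF norm_ge_zero *] show "0 \<le> a + b - \<delta> / 4 * (norm (1 - \<psi> (y - y')))\<^sup>2" .
    qed (use g in auto)
    finally show "norm (char_op \<kappa> n \<psi> g j) \<le> (1 - \<delta> / 4 * (norm (1 - \<psi> (y - y')))\<^sup>2) * B"
      by (simp add: algebra_simps)
  qed
qed

text \<open>
  The time \<open>N\<close> and the constant \<open>c\<close> are uniform in the character; this is what makes the final
  estimate quadratic near the trivial character.
\<close>

definition damped_direction :: "('s \<Rightarrow> ('g::ab_group_add \<times> 's) pmf) \<Rightarrow> 's \<Rightarrow> 'g \<Rightarrow> bool" where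
  "damped_direction \<kappa> j z \<longleftrightarrow> (\<exists>N c. 0 < c \<and>
     (\<forall>\<psi> n. character \<psi> \<longrightarrow> n \<ge> N \<longrightarrow> damps \<kappa> n \<psi> j (1 - c * (norm (1 - \<psi> z))\<^sup>2)))"

text \<open>
  Since \<open>|1 - \<psi>(z - z')| \<le> |1 - \<psi> z| + |1 - \<psi> z'|\<close>, the larger of the two terms on the right is at least half of the
  left-hand side, which costs a factor \<open>4\<close>.
\<close>

lemma damped_direction_diff:
  assumes "damped_direction \<kappa> j z" "damped_direction \<kappa> j z'"
  shows "damped_direction \<kappa> j (z - z')"
proof -
  obtain N c where c: "0 < c"
    "\<And>\<psi> n. character \<psi> \<Longrightarrow> n \<ge> N \<Longrightarrow> damps \<kappa> n \<psi> j (1 - c * (norm (1 - \<psi> z))\<^sup>2)"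
    using assms(1) unfolding damped_direction_def by blast
  obtain N' c' where c': "0 < c'"
    "\<And>\<psi> n. character \<psi> \<Longrightarrow> n \<ge> N' \<Longrightarrow> damps \<kappa> n \<psi> j (1 - c' * (norm (1 - \<psi> z'))\<^sup>2)"
    using assms(2) unfolding damped_direction_def by blast
  have "damps \<kappa> n \<psi> j (1 - min c c' / 4 * (norm (1 - \<psi> (z - z')))\<^sup>2)"
    if \<psi>: "character \<psi>" and n: "n \<ge> max N N'" for \<psi> n
  proof -
    define a b e where "a = norm (1 - \<psi> z)" and "b = norm (1 - \<psi> z')" and "e = norm (1 - \<psi> (z - z'))"
    have "e = norm ((1 - \<psi> z') - (1 - \<psi> z))"
      unfolding e_def by (simp add: norm_character_diff[OF \<psi>, symmetric])
    also have "\<dots> \<le> b + a" unfolding a_def b_def by (rule norm_triangle_ineq4)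
    finally have e: "0 \<le> e" "e \<le> a + b" "0 \<le> a" "0 \<le> b" by (auto simp: e_def a_def b_def)
    define h where "h = max a b"
    have "e \<le> 2 * h" using e by (simp add: h_def)
    then have "e\<^sup>2 \<le> (2 * h)\<^sup>2" using e(1) by (rule power_mono)
    then have "min c c' / 4 * e\<^sup>2 \<le> min c c' / 4 * (2 * h)\<^sup>2"
      using c(1) c'(1) by (intro mult_left_mono) auto
    then have e4: "min c c' / 4 * e\<^sup>2 \<le> min c c' * h\<^sup>2" by simp
    show ?thesis
    proof (cases "a \<ge> b")
      case True
      have "min c c' * h\<^sup>2 \<le> c * a\<^sup>2" using True by (simp add: h_def mult_right_mono)
      with e4 have "1 - c * a\<^sup>2 \<le> 1 - min c c' / 4 * e\<^sup>2" by linarith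
      then show ?thesis
        using c(2)[OF \<psi>, of n] n unfolding a_def e_def by (auto intro: damps_mono)
    next
      case False
      have "min c c' * h\<^sup>2 \<le> c' * b\<^sup>2" using False by (simp add: h_def mult_right_mono)
      with e4 have "1 - c' * b\<^sup>2 \<le> 1 - min c c' / 4 * e\<^sup>2" by linarith
      then show ?thesis
        using c'(2)[OF \<psi>, of n] n unfolding b_def e_def by (auto intro: damps_mono)
    qed
  qed
  moreover have "0 < min c c' / 4" using c(1) c'(1) by simp
  ultimately show ?thesis unfolding damped_direction_def by blast
qed

lemma damped_direction_pair:
  assumes "pmf (state_at \<kappa> n (0, j)) (y, j) > 0" "pmf (state_at \<kappa> n (0, j)) (y', j) > 0"
  shows "damped_direction \<kappa> j (y - y')"
proof -
  define \<delta> where "\<delta> = min (pmf (state_at \<kappa> n (0, j)) (y, j)) (pmf (state_at \<kappa> n (0, j)) (y', j))"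
  have "\<delta> > 0" using assms by (simp add: \<delta>_def)
  have "damps \<kappa> n' \<psi> j (1 - \<delta> / 4 * (norm (1 - \<psi> (y - y')))\<^sup>2)" if "character \<psi>" "n' \<ge> n" for \<psi> n'
    using that \<open>\<delta> > 0\<close> by (intro damps_later[OF _ damps_two_points[of \<psi> \<delta> \<kappa> n j y y']]) (auto simp: \<delta>_def)
  then show ?thesis using \<open>\<delta> > 0\<close> unfolding damped_direction_def
    by (intro exI[of _ n] exI[of _ "\<delta> / 4"]) auto
qed

text \<open>
  The generators in the condition of trivial arithmetic.
\<close>

definition loop_differences :: "('s \<Rightarrow> ('g::ab_group_add \<times> 's) pmf) \<Rightarrow> 's \<Rightarrow> 'g set" where
  "loop_differences \<kappa> j = {y - y' | y y'. \<exists>n\<ge>1.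
     pmf (state_at \<kappa> n (0, j)) (y, j) > 0 \<and> pmf (state_at \<kappa> n (0, j)) (y', j) > 0}"

lemma damped_direction_group_closure:
  assumes "z \<in> group_closure (loop_differences \<kappa> j)"
  shows "damped_direction \<kappa> j z"
  using assms
proof (induction rule: group_closure.induct)
  case (base z)
  \<comment> \<open>At time \<open>0\<close> the pair \<open>y = y' = 0\<close> is possible and has difference \<open>0\<close>.\<close>
  have "damped_direction \<kappa> j 0"
    using damped_direction_pair[of \<kappa> 0 j 0 0] by simp
  with base show ?case by (auto simp: loop_differences_def intro: damped_direction_pair)
qed (rule damped_direction_diff)

text \<open>
  There are finitely many internal states and finitely many directions in \<open>Z\<close>, so one time and one constant
  serve them all. The row norm is governed by the direction with the largest \<open>|1 - \<psi> z|\<close>, hence also by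
  the mean over \<open>Z\<close>.
\<close>

lemma uniform_damping:
  fixes \<kappa> :: "'s::finite \<Rightarrow> ('g::ab_group_add \<times> 's) pmf"
  assumes full: "\<And>j. group_closure (loop_differences \<kappa> j) = UNIV" and Z: "finite Z" "Z \<noteq> {}"
  obtains N c where "N \<ge> 1" "c > 0"
    "\<And>\<psi> j. character \<psi> \<Longrightarrow> damps \<kappa> N \<psi> j (exp (- c * (\<Sum>z\<in>Z. (norm (1 - \<psi> z))\<^sup>2)))"
proof -
  have "damped_direction \<kappa> j z" for j z
    by (rule damped_direction_group_closure) (simp add: full)
  then obtain N c where c0: "\<And>j z. 0 < c j z"
    and *: "\<And>j z \<psi> n. character \<psi> \<Longrightarrow> n \<ge> N j z \<Longrightarrow> damps \<kappa> n \<psi> j (1 - c j z * (norm (1 - \<psi> z))\<^sup>2)"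
    unfolding damped_direction_def by metis
  define N' where "N' = Suc (\<Sum>j\<in>UNIV. \<Sum>z\<in>Z. N j z)"
  define c' where "c' = Min ((\<lambda>(j, z). c j z) ` (UNIV \<times> Z))"
  have fin: "finite ((\<lambda>(j, z). c j z) ` (UNIV \<times> Z))" "(\<lambda>(j, z). c j z) ` (UNIV \<times> Z) \<noteq> {}"
    using Z by auto
  have c': "c' > 0" unfolding c'_def using fin c0 by (subst Min_gr_iff) auto
  have c'_le: "c' \<le> c j z" if "z \<in> Z" for j z
    unfolding c'_def by (rule Min_le[OF fin(1)]) (use that in \<open>auto intro!: image_eqI[of _ _ "(j, z)"]\<close>)
  have N': "N j z \<le> N'" if "z \<in> Z" for j z
  proof -
    have "N j z \<le> (\<Sum>z\<in>Z. N j z)" using that Z by (intro member_le_sum) auto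
    also have "\<dots> \<le> (\<Sum>j\<in>UNIV. \<Sum>z\<in>Z. N j z)" by (intro member_le_sum) auto
    finally show ?thesis by (simp add: N'_def)
  qed
  show thesis
  proof (rule that[of N' "c' / card Z"])
    fix \<psi> :: "'g \<Rightarrow> complex" and j assume \<psi>: "character \<psi>"
    define f where "f z = (norm (1 - \<psi> z))\<^sup>2" for z
    have "Max (f ` Z) \<in> f ` Z" using Z by (intro Max_in) auto
    then obtain z where z: "z \<in> Z" "f z = Max (f ` Z)" by auto
    have "f u \<le> f z" if "u \<in> Z" for u using Z that by (simp add: z(2))
    then have "(\<Sum>u\<in>Z. f u) \<le> card Z * f z" using sum_bounded_above[of Z f "f z"] by simp
    then have "c' / card Z * (\<Sum>u\<in>Z. f u) \<le> c' / card Z * (card Z * f z)"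
      using c' by (intro mult_left_mono) auto
    also have "\<dots> = c' * f z" using Z by simp
    also have "\<dots> \<le> c j z * f z" using c'_le[OF z(1)] by (intro mult_right_mono) (auto simp: f_def)
    finally have "1 - c j z * f z \<le> 1 + (- (c' / card Z) * (\<Sum>u\<in>Z. f u))" by simp
    also have "\<dots> \<le> exp (- (c' / card Z) * (\<Sum>u\<in>Z. f u))" by (rule exp_ge_add_one_self)
    finally have le: "1 - c j z * f z \<le> exp (- (c' / card Z) * (\<Sum>u\<in>Z. f u))" .
    from *[OF \<psi> N'[OF z(1)]] have "damps \<kappa> N' \<psi> j (1 - c j z * f z)"
      by (simp add: f_def)
    from damps_mono[OF this le] show "damps \<kappa> N' \<psi> j (exp (- (c' / card Z) * (\<Sum>z\<in>Z. (norm (1 - \<psi> z))\<^sup>2)))"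
      by (simp add: f_def)
  qed (use c' Z in \<open>auto simp: N'_def card_gt_0_iff\<close>)
qed

lemma damps_power:
  assumes \<psi>: "character \<psi>" and r: "r \<ge> 0" "\<And>j. damps \<kappa> N \<psi> j r"
    and g: "\<And>k. norm (g k) \<le> 1"
  shows "norm (char_op \<kappa> n \<psi> g j) \<le> r ^ (n div N)"
proof -
  have step: "norm (char_op \<kappa> (m * N) \<psi> h i) \<le> r ^ m" if h: "\<And>k. norm (h k) \<le> 1" for m h i
  proof (induction m arbitrary: i)
    case 0
    show ?case using norm_char_op_le[OF \<psi> h] by simp
  next
    case (Suc m)
    show ?case
      using dampsD[OF r(2) Suc.IH] by (simp add: char_op_add[OF \<psi> h])
  qed
  have "char_op \<kappa> (n div N * N + n mod N) \<psi> g j =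
      char_op \<kappa> (n div N * N) \<psi> (char_op \<kappa> (n mod N) \<psi> g) j"
    by (rule char_op_add[OF \<psi> g])
  then show ?thesis using step[OF norm_char_op_le[OF \<psi> g]] by simp
qed

section \<open>Return probabilities on the lattice\<close>

text \<open>
  The summands are the powers of a \<open>K\<close>-th root of unity. It only matters that the sum is real
  and nonnegative.
\<close>

lemma sum_roots_of_unity:
  assumes "K > 0"
  shows "(\<Sum>a<K. cis (2 * pi * real a * real_of_int x / real K)) \<in> {0, of_nat K}"
proof -
  define w where "w = cis (2 * pi * real_of_int x / real K)"
  have pow: "cis (2 * pi * real a * real_of_int x / real K) = w ^ a" for a
    unfolding w_def Complex.DeMoivre by (simp add: mult_ac)
  have "w ^ K = 1"
    using assms cis_multiple_2pi[of "real_of_int x"] by (simp add: w_def Complex.DeMoivre mult_ac)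
  then show ?thesis
    unfolding pow by (cases "w = 1") (auto simp: geometric_sum)
qed

text \<open>
  The characters of \<open>\<int>\<^sup>d\<close> that are trivial on \<open>K \<int>\<^sup>d\<close>, indexed by \<open>t\<close> with entries below \<open>K\<close>.
\<close>

definition lattice_character :: "nat \<Rightarrow> ('d \<Rightarrow> nat) \<Rightarrow> int ^ 'd::finite \<Rightarrow> complex" where
  "lattice_character K t y = (\<Prod>l\<in>UNIV. cis (2 * pi * real (t l) * real_of_int (y $ l) / real K))"

lemma character_lattice_character: "character (lattice_character K t)"
  by (simp add: character_def lattice_character_def add_divide_distrib ring_distribs prod.distrib
      flip: cis_mult prod_norm)

lemma lattice_character_axis:
  "lattice_character K t (axis l 1) = cis (2 * pi * real (t l) / real K)"
proof -
  have "lattice_character K t (axis l 1) =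
    (\<Prod>l'\<in>UNIV. if l' = l then cis (2 * pi * real (t l) / real K) else 1)"
    unfolding lattice_character_def by (intro prod.cong) (auto simp: axis_def)
  then show ?thesis by simp
qed

text \<open>
  The sum is \<open>K\<^sup>d\<close> times the indicator of \<open>K \<int>\<^sup>d\<close>; bounding it below by \<open>K\<^sup>d\<close> times the indicator of
  \<open>{0}\<close> is enough for an upper bound on return probabilities.
\<close>

lemma average_lattice_characters:
  assumes "K > 0"
  shows "Re (\<Sum>t\<in>UNIV \<rightarrow>\<^sub>E {..<K}. lattice_character K t (y :: int ^ 'd::finite)) \<ge> (if y = 0 then real K ^ CARD('d) else 0)"
proof -
  define R where "R l = (\<Sum>a<K. cis (2 * pi * real a * real_of_int (y $ l) / real K))" for l
  have sum: "(\<Sum>t\<in>UNIV \<rightarrow>\<^sub>E {..<K}. lattice_character K t y) = (\<Prod>l\<in>UNIV. R l)"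
    unfolding lattice_character_def R_def by (rule prod_sum_PiE[symmetric]) auto
  have "R l = of_real (Re (R l)) \<and> Re (R l) \<ge> 0" for l
    using sum_roots_of_unity[OF assms, of "y $ l"] by (auto simp: R_def simp del: of_real_sum Re_sum)
  then have R: "R l = of_real (Re (R l))" "Re (R l) \<ge> 0" for l by auto
  have "(\<Prod>l\<in>UNIV. R l) = of_real (\<Prod>l\<in>UNIV. Re (R l))"
    unfolding of_real_prod by (intro prod.cong refl R(1))
  then have "Re (\<Prod>l\<in>UNIV. R l) = (\<Prod>l\<in>UNIV. Re (R l))" by (simp only: Re_complex_of_real)
  moreover have "(\<Prod>l\<in>UNIV. Re (R l)) \<ge> 0" using R(2) by (intro prod_nonneg) auto
  moreover have "(\<Prod>l\<in>UNIV. Re (R l)) = real K ^ CARD('d)" if "y = 0"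
    using that by (simp add: R_def)
  ultimately show ?thesis unfolding sum by simp
qed

text \<open>
  The sine is concave on \<open>[0, \<pi>/2]\<close>, so it lies above the chord.
\<close>

lemma sin_ge_chord:
  assumes "0 \<le> x" "x \<le> pi / 2"
  shows "sin x \<ge> 2 * x / pi"
proof -
  have "convex_on {0..pi/2} (\<lambda>x. - sin x)"
    by (rule f''_ge0_imp_convex[where f' = "\<lambda>x. - cos x" and f'' = sin])
       (auto intro!: derivative_eq_intros sin_ge_zero)
  from convex_onD[OF this, of "2 * x / pi" 0 "pi / 2"] show ?thesis
    using assms by (auto simp: field_simps)
qed

lemma norm_1_minus_cis_ge:
  assumes "a < K"
  shows "norm (1 - cis (2 * pi * real a / real K)) \<ge> 4 * real (min a (K - a)) / real K"
proof -
  have K: "K > 0" using assms by simp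
  have "norm (1 - cis (2 * pi * real a / real K)) = 2 * \<bar>sin (pi * real a / real K)\<bar>"
    using dist_exp_i_1[of "2 * pi * real a / real K"]
    by (simp add: cis_conv_exp norm_minus_commute)
  moreover have "\<bar>sin (pi * real a / real K)\<bar> \<ge> 2 * real (min a (K - a)) / real K"
  proof (cases "2 * a \<le> K")
    case True
    then have "2 * real a \<le> real K" by linarith
    then have "sin (pi * real a / real K) \<ge> 2 * (pi * real a / real K) / pi"
      using K by (intro sin_ge_chord) (auto simp: field_simps)
    moreover have "2 * (pi * real a / real K) / pi = 2 * real (min a (K - a)) / real K"
      using True by simp
    ultimately show ?thesis by linarith
  next
    case False
    then have "real K \<le> 2 * real a" by linarith
    have eq: "pi * real a / real K = pi - pi * real (K - a) / real K"
      using assms by (simp add: of_nat_diff field_simps)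
    have "pi * real (K - a) / real K \<le> pi / 2"
      using K assms \<open>real K \<le> 2 * real a\<close> by (simp add: of_nat_diff field_simps)
    then have "sin (pi * real (K - a) / real K) \<ge> 2 * (pi * real (K - a) / real K) / pi"
      by (intro sin_ge_chord) auto
    moreover have "2 * (pi * real (K - a) / real K) / pi = 2 * real (min a (K - a)) / real K"
      using False by simp
    ultimately show ?thesis unfolding eq sin_pi_minus by linarith
  qed
  ultimately show ?thesis by simp
qed

text \<open>
  If \<open>b\<close> is the distance from \<open>a\<close> to the nearest multiple of \<open>K\<close>, the exponent is at most
  \<open>-16 c m b\<^sup>2 / K\<^sup>2 \<le> -16 c b\<close>, because \<open>K\<^sup>2 \<le> m\<close> and \<open>b \<le> b\<^sup>2\<close>. So the sum is dominated by two geometric series,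
  one from each end, independently of \<open>K\<close> and \<open>m\<close>.
\<close>

lemma theta_sum_bound:
  assumes c: "c > 0" and m: "K\<^sup>2 \<le> m"
  shows "(\<Sum>a<K. exp (- c * real m * (norm (1 - cis (2 * pi * real a / real K)))\<^sup>2)) \<le> 2 / (1 - exp (- 16 * c))"
proof -
  define q where "q = exp (- 16 * c)"
  have q: "0 < q" "q < 1" using c by (auto simp: q_def)
  \<comment> \<open>The summand \<open>q ^ a\<close> covers the \<open>a\<close> near \<open>0\<close>, and \<open>q ^ (K - Suc a)\<close> those near \<open>K\<close>.\<close>
  have term_le: "exp (- c * real m * (norm (1 - cis (2 * pi * real a / real K)))\<^sup>2) \<le> q ^ a + q ^ (K - Suc a)"
    if a: "a < K" for a
  proof -
    define b where "b = min a (K - a)"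
    have K: "K > 0" using a by simp
    have "(4 * real b / real K)\<^sup>2 \<le> (norm (1 - cis (2 * pi * real a / real K)))\<^sup>2"
      using norm_1_minus_cis_ge[OF a] by (intro power_mono) (auto simp: b_def)
    then have "real m * (4 * real b / real K)\<^sup>2 \<le> real m * (norm (1 - cis (2 * pi * real a / real K)))\<^sup>2"
      by (intro mult_left_mono) auto
    moreover have "real (K\<^sup>2) * (4 * real b / real K)\<^sup>2 \<le> real m * (4 * real b / real K)\<^sup>2"
      using m by (intro mult_right_mono) (auto simp del: of_nat_power)
    moreover have "real (K\<^sup>2) * (4 * real b / real K)\<^sup>2 = 16 * (real b)\<^sup>2"
      using K by (simp add: field_simps power2_eq_square)
    moreover have "real b \<le> (real b)\<^sup>2"
      by (cases b) (auto simp: power2_eq_square)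
    ultimately have "16 * real b \<le> real m * (norm (1 - cis (2 * pi * real a / real K)))\<^sup>2"
      by linarith
    then have "c * (16 * real b) \<le> c * (real m * (norm (1 - cis (2 * pi * real a / real K)))\<^sup>2)"
      using c by (intro mult_left_mono) auto
    then have "exp (- c * real m * (norm (1 - cis (2 * pi * real a / real K)))\<^sup>2) \<le> exp (real b * (- 16 * c))"
      by (simp add: algebra_simps)
    also have "\<dots> = q ^ b" unfolding q_def by (rule exp_of_nat_mult)
    also have "\<dots> \<le> q ^ a + q ^ (K - Suc a)"
    proof (cases "a \<le> K - a")
      case True
      then show ?thesis using q by (simp add: b_def)
    next
      case False
      then have "q ^ b \<le> q ^ (K - Suc a)" using q by (intro power_decreasing) (auto simp: b_def)
      then show ?thesis using q by (simp add: add_increasing)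
    qed
    finally show ?thesis .
  qed
  have geo: "(\<Sum>a<K. q ^ a) \<le> 1 / (1 - q)"
    using q by (simp add: sum_gp_strict divide_right_mono)
  have "(\<Sum>a<K. exp (- c * real m * (norm (1 - cis (2 * pi * real a / real K)))\<^sup>2)) \<le> (\<Sum>a<K. q ^ a + q ^ (K - Suc a))"
    using term_le by (intro sum_mono) auto
  also have "\<dots> = 2 * (\<Sum>a<K. q ^ a)"
    by (simp add: sum.distrib sum.nat_diff_reindex)
  also have "\<dots> \<le> 2 * (1 / (1 - q))" using geo by simp
  finally show ?thesis by (simp add: q_def)
qed

text \<open>
  Averaging over the characters modulo \<open>K\<close> turns the damping into a product of \<open>d\<close> one-dimensional sums, each
  bounded by a constant \<open>B\<close>, so the return probability is at most \<open>(B/K)\<^sup>d\<close> as long as \<open>K\<^sup>2 \<le> n div N\<close>. The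
  choice \<open>K \<approx> \<surd>(n div N)\<close> gives the rate.
\<close>

lemma return_probability_bound:
  fixes \<kappa> :: "'s::finite \<Rightarrow> ((int ^ 'd) \<times> 's) pmf"
  assumes full: "\<And>j. group_closure (loop_differences \<kappa> j) = UNIV"
  obtains C where "C \<ge> 0"
    "\<And>n j. n \<ge> 1 \<Longrightarrow> measure_pmf.prob (state_at \<kappa> n (0, j)) ({0} \<times> UNIV) \<le> C * real n powr (- real CARD('d) / 2)"
proof -
  obtain N c where N: "N \<ge> 1" and c: "c > 0"
    and damp: "\<And>\<psi> j. character \<psi> \<Longrightarrow>
      damps \<kappa> N \<psi> j (exp (- c * (\<Sum>z\<in>range (\<lambda>l. axis l 1). (norm (1 - \<psi> z))\<^sup>2)))"
    using uniform_damping[OF full, of "range (\<lambda>l. axis l 1)"] by auto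
  define B where "B = 2 / (1 - exp (- 16 * c))"
  have B: "B \<ge> 1" using c by (simp add: B_def field_simps add_increasing)
  let ?p = "\<lambda>n j. measure_pmf.prob (state_at \<kappa> n (0, j)) ({0} \<times> UNIV)"
  have avg: "?p n j \<le> (B / real K) ^ CARD('d)" if K: "K > 0" "K\<^sup>2 \<le> n div N" for n j K
  proof -
    let ?T = "(UNIV :: 'd set) \<rightarrow>\<^sub>E {..<K}"
    let ?q = "state_at \<kappa> n (0, j)"
    define m where "m = n div N"
    have fin: "finite ?T" by (intro finite_PiE) auto
    \<comment> \<open>The unit vectors turn the damping exponent into a sum over the coordinates of \<open>t\<close>.\<close>
    have op: "norm (char_op \<kappa> n (lattice_character K t) (\<lambda>_. 1) j)
        \<le> (\<Prod>l\<in>UNIV. exp (- c * real m * (norm (1 - cis (2 * pi * real (t l) / real K)))\<^sup>2))" for t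
    proof -
      let ?S = "\<Sum>l\<in>UNIV. (norm (1 - cis (2 * pi * real (t l) / real K)))\<^sup>2"
      have inj: "inj (\<lambda>l::'d. axis l (1::int))" by (auto simp: inj_def axis_eq_axis)
      have "(\<Sum>z\<in>range (\<lambda>l. axis l 1). (norm (1 - lattice_character K t z))\<^sup>2) = ?S"
        by (simp add: sum.reindex[OF inj] lattice_character_axis)
      with damp[OF character_lattice_character[of K t]]
      have "damps \<kappa> N (lattice_character K t) j (exp (- c * ?S))" for j by simp
      from damps_power[OF character_lattice_character _ this, of "\<lambda>_. 1" n j]
      have "norm (char_op \<kappa> n (lattice_character K t) (\<lambda>_. 1) j) \<le> exp (- c * ?S) ^ m"
        by (simp add: m_def)
      also have "\<dots> = exp (\<Sum>l\<in>UNIV. - c * real m * (norm (1 - cis (2 * pi * real (t l) / real K)))\<^sup>2)"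
        unfolding exp_of_nat_mult[symmetric] sum_distrib_left by (simp add: mult_ac)
      also have "\<dots> = (\<Prod>l\<in>UNIV. exp (- c * real m * (norm (1 - cis (2 * pi * real (t l) / real K)))\<^sup>2))"
        by (simp add: exp_sum)
      finally show ?thesis .
    qed
    have int: "integrable (measure_pmf ?q) (\<lambda>s. lattice_character K t (fst s))" for t
      by (rule pmf_integrable_bounded[where B = 1]) (simp add: norm_character character_lattice_character)
    have "real K ^ CARD('d) * ?p n j = measure_pmf.expectation ?q (\<lambda>s. if fst s = 0 then real K ^ CARD('d) else 0)"
    proof -
      have "measure_pmf.expectation ?q (\<lambda>s. if fst s = 0 then real K ^ CARD('d) else 0) =
          measure_pmf.expectation ?q (\<lambda>s. real K ^ CARD('d) * indicator ({0} \<times> UNIV) s)"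
        by (intro Bochner_Integration.integral_cong) (auto simp: indicator_def)
      then show ?thesis by simp
    qed
    also have "\<dots> \<le> measure_pmf.expectation ?q (\<lambda>s. Re (\<Sum>t\<in>?T. lattice_character K t (fst s)))"
      by (intro average_lattice_characters[OF K(1)] integral_mono integrable_Re Bochner_Integration.integrable_sum int
          pmf_integrable_bounded[where B = "real K ^ CARD('d)"]) auto
    also have "\<dots> = Re (\<Sum>t\<in>?T. char_op \<kappa> n (lattice_character K t) (\<lambda>_. 1) j)"
      using int by (simp add: char_op_def integral_Re del: Re_sum)
    also have "\<dots> \<le> norm (\<Sum>t\<in>?T. char_op \<kappa> n (lattice_character K t) (\<lambda>_. 1) j)"
      by (rule complex_Re_le_cmod)
    also have "\<dots> \<le> (\<Sum>t\<in>?T. norm (char_op \<kappa> n (lattice_character K t) (\<lambda>_. 1) j))"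
      by (rule norm_sum)
    also have "\<dots> \<le> (\<Sum>t\<in>?T. \<Prod>l\<in>UNIV. exp (- c * real m * (norm (1 - cis (2 * pi * real (t l) / real K)))\<^sup>2))"
      by (intro sum_mono op)
    also have "\<dots> = (\<Prod>l\<in>(UNIV :: 'd set). \<Sum>a<K. exp (- c * real m * (norm (1 - cis (2 * pi * real a / real K)))\<^sup>2))"
      by (rule prod_sum_PiE[symmetric]) auto
    also have "\<dots> \<le> (\<Prod>l\<in>(UNIV :: 'd set). B)"
      using theta_sum_bound[OF c, of K m] K(2) by (intro prod_mono) (auto simp: B_def m_def intro!: sum_nonneg)
    finally show ?thesis using K(1) by (simp add: power_divide field_simps)
  qed
  \<comment> \<open>The factor \<open>8 N\<close> comes from \<open>n \<le> 2 N (n div N)\<close> and \<open>n div N \<le> 4 K\<^sup>2\<close>, where \<open>K\<close> is the integer square root.\<close>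
  define C where "C = (B * sqrt (8 * real N)) powr real CARD('d)"
  have "?p n j \<le> C * real n powr (- real CARD('d) / 2)" if n: "n \<ge> 1" for n j
  proof -
    have scale: "C * real n powr (- real CARD('d) / 2) = (B * sqrt (8 * real N) / sqrt (real n)) ^ CARD('d)"
    proof -
      have X: "real n powr (- real CARD('d) / 2) = (1 / sqrt (real n)) powr real CARD('d)"
        using n by (simp add: powr_half_sqrt[symmetric] powr_powr powr_minus_divide powr_divide)
      have "C * real n powr (- real CARD('d) / 2) = (B * sqrt (8 * real N) * (1 / sqrt (real n))) powr real CARD('d)"
        unfolding C_def X by (rule powr_mult[symmetric])
      also have "\<dots> = (B * sqrt (8 * real N) / sqrt (real n)) ^ CARD('d)"
        using B N n by (subst powr_realpow) auto
      finally show ?thesis .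
    qed
    show ?thesis
    proof (cases "n < N")
      case True
      have "sqrt (real n) \<le> sqrt (8 * real N)" using True by simp
      also have "\<dots> \<le> B * sqrt (8 * real N)" using B by (simp add: mult_le_cancel_right1)
      finally have "1 \<le> B * sqrt (8 * real N) / sqrt (real n)" using n by simp
      then have "1 \<le> (B * sqrt (8 * real N) / sqrt (real n)) ^ CARD('d)" by (rule one_le_power)
      then show ?thesis unfolding scale using measure_pmf.prob_le_1 order_trans by blast
    next
      case False
      define m where "m = n div N"
      define K where "K = floor_sqrt m"
      have m: "m \<ge> 1" using False N by (simp add: m_def Suc_le_eq div_greater_zero_iff)
      have K: "K > 0" "K\<^sup>2 \<le> m" "m < (Suc K)\<^sup>2"
        using m by (auto simp: K_def floor_sqrt_power2_le Suc_floor_sqrt_power2_gt)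
      have "n < N * Suc m" using N by (simp add: m_def dividend_less_times_div)
      also have "\<dots> \<le> N * (2 * m)" using m by (intro mult_left_mono) auto
      also have "\<dots> \<le> N * (2 * (4 * K\<^sup>2))"
      proof -
        have "(Suc K)\<^sup>2 \<le> (2 * K)\<^sup>2" using K(1) by (intro power_mono) auto
        then have "m \<le> 4 * K\<^sup>2" using K(3) by (simp add: power_mult_distrib)
        then show ?thesis by simp
      qed
      finally have "real n \<le> real (8 * N * K\<^sup>2)" by (simp del: of_nat_mult of_nat_power)
      then have "sqrt (real n) \<le> sqrt (8 * real N * (real K)\<^sup>2)" by (simp add: mult_ac)
      then have "sqrt (real n) \<le> sqrt (8 * real N) * real K" by (simp add: real_sqrt_mult)
      then have "1 / real K \<le> sqrt (8 * real N) / sqrt (real n)" using n K(1) by (simp add: field_simps)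
      then have "B * (1 / real K) \<le> B * (sqrt (8 * real N) / sqrt (real n))" using B by (intro mult_left_mono) auto
      then have "(B / real K) ^ CARD('d) \<le> (B * sqrt (8 * real N) / sqrt (real n)) ^ CARD('d)"
        using B by (intro power_mono) auto
      with avg[OF K(1) K(2)[unfolded m_def], of j] show ?thesis unfolding scale by linarith
    qed
  qed
  moreover have "C \<ge> 0" by (simp add: C_def)
  ultimately show thesis by (rule that[rotated])
qed

section \<open>Sums of slowly decreasing sequences\<close>

lemma powr_le_diff_antiderivative:
  assumes F: "\<And>x. x > 0 \<Longrightarrow> (F has_real_derivative x powr e) (at x)" and e: "e \<le> 0" and m: "m \<ge> 1"
  shows "real (Suc m) powr e \<le> F (real (Suc m)) - F (real m)"
proof -
  obtain z where z: "real m < z" "z < real (Suc m)" "F (real (Suc m)) - F (real m) = (real (Suc m) - real m) * z powr e"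
    using MVT2[of "real m" "real (Suc m)" F "\<lambda>x. x powr e"] F m by force
  have "real (Suc m) powr e \<le> z powr e" using z m e by (intro powr_mono2') auto
  then show ?thesis using z(3) by simp
qed

lemma sum_powr_le_antiderivative:
  assumes F: "\<And>x. x > 0 \<Longrightarrow> (F has_real_derivative x powr e) (at x)" and e: "e \<le> 0" and n: "n \<ge> 1"
  shows "(\<Sum>m=1..n. real m powr e) \<le> 1 + F (real n) - F 1"
  using n
proof (induction n rule: dec_induct)
  case (step n)
  then show ?case using powr_le_diff_antiderivative[OF F e, of n] by simp
qed simp

text \<open>
  Adding an antiderivative of \<open>C x\<^bsup>-e\<^esup>\<close> to the decreasing sequence \<open>g\<close> makes it increasing, so the
  limit is squeezed between the two.
\<close>

lemma monotone_limit_rate: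
  fixes g :: "nat \<Rightarrow> real"
  assumes e: "e > 1" and C: "C \<ge> 0"
    and g: "\<And>m. 0 \<le> g m - g (Suc m)" "\<And>m. g m - g (Suc m) \<le> C * real (Suc m) powr (- e)"
  obtains L where "\<And>m. g m \<ge> L" "\<And>m. m \<ge> 1 \<Longrightarrow> g m - L \<le> C / (e - 1) * real m powr (1 - e)"
proof -
  define F where "F x = x powr (1 - e) / (1 - e)" for x :: real
  have F: "(F has_real_derivative x powr (- e)) (at x)" if "x > 0" for x
    unfolding F_def using that e by (auto intro!: derivative_eq_intros simp: divide_simps)
  \<comment> \<open>The shift by one keeps the argument of \<open>F\<close> positive.\<close>
  define f where "f m = g (Suc m) + C * F (real (Suc m))" for m
  have dec: "decseq g" using g(1) by (intro decseq_SucI) (simp add: algebra_simps)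
  have "incseq f"
  proof (rule incseq_SucI)
    fix m
    have "C * real (Suc (Suc m)) powr (- e) \<le> C * (F (real (Suc (Suc m))) - F (real (Suc m)))"
      using powr_le_diff_antiderivative[OF F, of "Suc m"] e C by (intro mult_left_mono) auto
    with g(2)[of "Suc m"] show "f m \<le> f (Suc m)" by (simp add: f_def algebra_simps)
  qed
  moreover have "f m \<le> g 0" for m
  proof -
    have "F (real (Suc m)) \<le> 0" using e by (simp add: F_def divide_nonneg_neg)
    then have "C * F (real (Suc m)) \<le> 0" using C by (simp add: mult_nonneg_nonpos)
    moreover have "g (Suc m) \<le> g 0" using dec by (auto simp: decseq_def)
    ultimately show ?thesis by (simp add: f_def)
  qed
  ultimately obtain L where L: "f \<longlonglongrightarrow> L" "\<And>m. f m \<le> L"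
    using incseq_convergent[of f "g 0"] by blast
  have "(\<lambda>m. F (real (Suc m))) \<longlonglongrightarrow> 0 / (1 - e)"
    unfolding F_def using e
    by (intro tendsto_divide tendsto_neg_powr filterlim_compose[OF filterlim_real_sequentially filterlim_Suc]) auto
  then have "(\<lambda>m. f m - C * F (real (Suc m))) \<longlonglongrightarrow> L - C * 0"
    using L(1) by (intro tendsto_intros) auto
  then have "(\<lambda>m. g (Suc m)) \<longlonglongrightarrow> L" by (simp add: f_def)
  then have "g \<longlonglongrightarrow> L" by (rule filterlim_sequentially_Suc[THEN iffD1])
  show thesis
  proof (rule that[of L])
    show "g m \<ge> L" for m using decseq_ge[OF dec \<open>g \<longlonglongrightarrow> L\<close>] .
    show "g m - L \<le> C / (e - 1) * real m powr (1 - e)" if "m \<ge> 1" for m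
      using L(2)[of "m - 1"] that e by (auto simp: f_def F_def divide_simps algebra_simps)
  qed
qed

text \<open>
  Here \<open>h m - \<gamma>\<close> decays like \<open>m\<^bsup>-e\<^esup>\<close> with \<open>e = d/2 - 1\<close>. For \<open>d \<le> 4\<close> its partial sums are compared with an
  antiderivative; for \<open>d \<ge> 5\<close> they converge, and the rate lemma applies a second time, to the negated partial sums.
\<close>

lemma sum_asymptotics:
  fixes h :: "nat \<Rightarrow> real" and d :: nat
  assumes d: "d \<ge> 3" and C: "C \<ge> 0"
    and h: "\<And>m. 0 \<le> h m - h (Suc m)" "\<And>m. h m - h (Suc m) \<le> C * real (Suc m) powr (- real d / 2)"
  shows "\<exists>\<gamma> \<beta> :: real.
    (d = 3 \<longrightarrow> (\<lambda>n. (\<Sum>m\<le>n. h m) - real n * \<gamma>) \<in> O(\<lambda>n. sqrt (real n))) \<and>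
    (d = 4 \<longrightarrow> (\<lambda>n. (\<Sum>m\<le>n. h m) - real n * \<gamma>) \<in> O(\<lambda>n. ln (real n))) \<and>
    (d \<ge> 5 \<longrightarrow> (\<lambda>n. (\<Sum>m\<le>n. h m) - (real n * \<gamma> + \<beta>)) \<in> O(\<lambda>n. real n powr (2 - real d / 2)))"
proof -
  define e where "e = real d / 2 - 1"
  have e: "e > 0" using d by (simp add: e_def)
  obtain \<gamma> where \<gamma>: "\<And>m. h m \<ge> \<gamma>" "\<And>m. m \<ge> 1 \<Longrightarrow> h m - \<gamma> \<le> C / e * real m powr (- e)"
    using monotone_limit_rate[of "real d / 2" C h] d C h by (auto simp: e_def)
  define C' where "C' = C / e"
  have C': "C' \<ge> 0" using C e by (simp add: C'_def)
  have split: "(\<Sum>m\<le>n. h m) - real n * \<gamma> = h 0 + (\<Sum>m=1..n. h m - \<gamma>)" for n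
    by (simp add: sum_subtractf sum.atMost_shift sum.atLeast1_atMost_eq lessThan_Suc_atMost)
  have D: "0 \<le> (\<Sum>m=1..n. h m - \<gamma>)" "(\<Sum>m=1..n. h m - \<gamma>) \<le> C' * (\<Sum>m=1..n. real m powr (- e))" for n
    unfolding sum_distrib_left using \<gamma> by (auto intro!: sum_nonneg sum_mono simp: C'_def)
  have bd: "\<bar>(\<Sum>m\<le>n. h m) - real n * \<gamma>\<bar> \<le> \<bar>h 0\<bar> + C' * (1 + F (real n) - F 1)"
    if F: "\<And>x. x > 0 \<Longrightarrow> (F has_real_derivative x powr (- e)) (at x)" and "n \<ge> 1" for F n
  proof -
    have "C' * (\<Sum>m=1..n. real m powr (- e)) \<le> C' * (1 + F (real n) - F 1)"
      using sum_powr_le_antiderivative[OF F _ \<open>n \<ge> 1\<close>] e C' by (intro mult_left_mono) auto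
    then show ?thesis unfolding split using D[of n] by linarith
  qed
  have three: "(\<lambda>n. (\<Sum>m\<le>n. h m) - real n * \<gamma>) \<in> O(\<lambda>n. sqrt (real n))" if "d = 3"
  proof (rule bigoI[where c = "\<bar>h 0\<bar> + 2 * C'"], rule eventually_sequentiallyI[of 1])
    fix n :: nat assume n: "n \<ge> 1"
    have F: "((\<lambda>x. 2 * sqrt x) has_real_derivative x powr (- e)) (at x)" if "x > 0" for x
      using that \<open>d = 3\<close> by (auto intro!: derivative_eq_intros simp: e_def powr_minus powr_half_sqrt field_simps)
    have "\<bar>(\<Sum>m\<le>n. h m) - real n * \<gamma>\<bar> \<le> \<bar>h 0\<bar> + C' * (1 + 2 * sqrt (real n) - 2 * sqrt 1)"
      by (rule bd[OF F n])
    also have "\<dots> \<le> \<bar>h 0\<bar> * sqrt (real n) + C' * (2 * sqrt (real n))"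
      using n C' by (intro add_mono mult_left_mono) (auto simp: mult_le_cancel_left1)
    finally show "norm ((\<Sum>m\<le>n. h m) - real n * \<gamma>) \<le> (\<bar>h 0\<bar> + 2 * C') * norm (sqrt (real n))"
      by (simp add: algebra_simps)
  qed
  have four: "(\<lambda>n. (\<Sum>m\<le>n. h m) - real n * \<gamma>) \<in> O(\<lambda>n. ln (real n))" if "d = 4"
  proof (rule bigoI[where c = "\<bar>h 0\<bar> + 2 * C'"], rule eventually_sequentiallyI[of 3])
    fix n :: nat assume n: "n \<ge> 3"
    have "1 \<le> ln (real n)"
      using n exp_le by (subst ln_ge_iff) auto
    have F: "(ln has_real_derivative x powr (- e)) (at x)" if "x > 0" for x
      using that \<open>d = 4\<close> by (auto intro!: derivative_eq_intros simp: e_def powr_minus field_simps)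
    have "\<bar>(\<Sum>m\<le>n. h m) - real n * \<gamma>\<bar> \<le> \<bar>h 0\<bar> + C' * (1 + ln (real n) - ln 1)"
      by (rule bd[OF F]) (use n in auto)
    also have "\<dots> \<le> \<bar>h 0\<bar> * ln (real n) + C' * (2 * ln (real n))"
      using \<open>1 \<le> ln (real n)\<close> C' by (intro add_mono mult_left_mono) (auto simp: mult_le_cancel_left1)
    finally show "norm ((\<Sum>m\<le>n. h m) - real n * \<gamma>) \<le> (\<bar>h 0\<bar> + 2 * C') * norm (ln (real n))"
      using \<open>1 \<le> ln (real n)\<close> by (simp add: algebra_simps)
  qed
  have five: "\<exists>\<beta>. (\<lambda>n. (\<Sum>m\<le>n. h m) - (real n * \<gamma> + \<beta>)) \<in> O(\<lambda>n. real n powr (2 - real d / 2))" if "d \<ge> 5"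
  proof -
    have e1: "e > 1" using that by (simp add: e_def)
    define g where "g n = - (\<Sum>m=1..n. h m - \<gamma>)" for n
    have gd: "0 \<le> g m - g (Suc m)" "g m - g (Suc m) \<le> C' * real (Suc m) powr (- e)" for m
      using \<gamma>(1)[of "Suc m"] \<gamma>(2)[of "Suc m"] by (simp_all add: g_def C'_def)
    obtain L where L: "\<And>m. g m \<ge> L" "\<And>m. m \<ge> 1 \<Longrightarrow> g m - L \<le> C' / (e - 1) * real m powr (1 - e)"
      using monotone_limit_rate[OF e1 C' gd] by blast
    have eq: "(\<Sum>m\<le>n. h m) - (real n * \<gamma> + (h 0 - L)) = L - g n" for n
      using split[of n] by (simp add: g_def)
    have "(\<lambda>n. (\<Sum>m\<le>n. h m) - (real n * \<gamma> + (h 0 - L))) \<in> O(\<lambda>n. real n powr (2 - real d / 2))"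
      unfolding eq
    proof (rule bigoI[where c = "C' / (e - 1)"], rule eventually_sequentiallyI[of 1])
      fix n :: nat assume "n \<ge> 1"
      then show "norm (L - g n) \<le> C' / (e - 1) * norm (real n powr (2 - real d / 2))"
        using L[of n] by (simp add: e_def)
    qed
    then show ?thesis by blast
  qed
  show ?thesis
    using three four five by (cases "d \<ge> 5") auto
qed

section \<open>From weights and processes to kernels and paths\<close>

definition jump_kernel :: "(int ^ 'd \<Rightarrow> 's::finite \<Rightarrow> 's \<Rightarrow> real) \<Rightarrow> 's \<Rightarrow> ((int ^ 'd) \<times> 's) pmf" where
  "jump_kernel p j = embed_pmf (\<lambda>(y, k). p y j k)"

lemma pmf_jump_kernel:
  assumes "rw_weights p"
  shows "pmf (jump_kernel p j) (y, k) = p y j k"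
proof -
  let ?f = "\<lambda>(y, k). p y j k"
  have nonneg: "?f x \<ge> 0" for x using assms by (auto simp: rw_weights_def split: prod.split)
  have sum: "(?f has_sum 1) UNIV" using assms by (simp add: rw_weights_def)
  have abs: "Infinite_Set_Sum.abs_summable_on ?f UNIV"
    unfolding abs_summable_equivalent[symmetric]
  proof -
    have "(\<lambda>x. norm (?f x)) = ?f" using nonneg by (intro ext) (simp only: real_norm_def abs_of_nonneg)
    then show "(\<lambda>x. norm (?f x)) summable_on UNIV" using has_sum_imp_summable[OF sum] by simp
  qed
  then have "(\<integral>\<^sup>+x. ?f x \<partial>count_space UNIV) = ennreal (integral\<^sup>L (count_space UNIV) ?f)"
    using nonneg by (intro nn_integral_eq_integral) (auto simp: Infinite_Set_Sum.abs_summable_on_def)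
  also have "integral\<^sup>L (count_space UNIV) ?f = 1"
    using infsetsum_infsum[OF abs] infsumI[OF sum] by (simp add: infsetsum_def)
  finally have "pmf (embed_pmf ?f) (y, k) = ?f (y, k)"
    using nonneg by (intro pmf_embed_pmf) auto
  then show ?thesis by (simp add: jump_kernel_def)
qed

lemma pmf_jump_step:
  fixes p :: "int ^ 'd \<Rightarrow> 's::finite \<Rightarrow> 's \<Rightarrow> real"
  assumes "rw_weights p"
  shows "pmf (jump_step (jump_kernel p) s) s' = p (fst s' - fst s) (snd s) (snd s')"
proof -
  have inj: "inj (apfst ((+) (fst s)) :: (int ^ 'd) \<times> 's \<Rightarrow> _)"
    by (auto simp: inj_def)
  have "s' = apfst ((+) (fst s)) (fst s' - fst s, snd s')" by simp
  then have "pmf (jump_step (jump_kernel p) s) s' = pmf (jump_kernel p (snd s)) (fst s' - fst s, snd s')"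
    unfolding jump_step_def using pmf_map_inj'[OF inj] by metis
  then show ?thesis by (simp add: pmf_jump_kernel[OF assms])
qed

lemma A_mat_has_sum:
  assumes "rw_weights p"
  shows "(A_mat p has_sum (\<chi> j k. pmf (map_pmf snd (jump_kernel p j)) k)) UNIV"
proof (intro has_sum_vec)
  fix j k
  let ?q = "jump_kernel p j"
  have "((\<lambda>s. pmf ?q s * indicator {s. snd s = k} s) has_sum
      measure_pmf.expectation ?q (indicator {s. snd s = k})) UNIV"
    using pmf_expectation_has_sum[of "indicator {s. snd s = k}" 1 ?q] by (simp add: indicator_def)
  from has_sum_finite_fibres[OF this]
  have "((\<lambda>y. \<Sum>i\<in>UNIV. pmf ?q (y, i) * indicator {s. snd s = k} (y, i)) has_sum
      measure_pmf.expectation ?q (indicator {s. snd s = k})) UNIV" .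
  also have "(\<lambda>y. \<Sum>i\<in>UNIV. pmf ?q (y, i) * indicator {s. snd s = k} (y, i)) = (\<lambda>y. A_mat p y $ j $ k)"
    by (auto simp: A_mat_def indicator_def pmf_jump_kernel[OF assms] if_distrib cong: if_cong)
  also have "measure_pmf.expectation ?q (indicator {s. snd s = k}) = pmf (map_pmf snd ?q) k"
    by (simp add: pmf_map vimage_def)
  finally show "((\<lambda>y. A_mat p y $ j $ k) has_sum (\<chi> j k. pmf (map_pmf snd (jump_kernel p j)) k) $ j $ k) UNIV"
    by simp
qed

lemma Q_mat_eq:
  assumes "rw_weights p"
  shows "Q_mat p $ j $ k = pmf (map_pmf snd (jump_kernel p j)) k"
  unfolding Q_mat_def infsumI[OF A_mat_has_sum[OF assms]] by simp

text \<open>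
  Both sides condition on the first jump; the convolution over \<open>z\<close> is translation invariance of the walk.
\<close>

lemma nstep_mat_eq:
  fixes p :: "int ^ 'd \<Rightarrow> 's::finite \<Rightarrow> 's \<Rightarrow> real"
  assumes "rw_weights p"
  shows "nstep_mat p n y $ j $ k = pmf (state_at (jump_kernel p) n (0, j)) (y, k)"
proof (induction n arbitrary: y j k)
  case 0
  show ?case by (auto simp: mat_def indicator_def)
next
  case (Suc n)
  let ?\<kappa> = "jump_kernel p"
  have inj: "inj (apfst ((+) x) :: (int ^ 'd) \<times> 's \<Rightarrow> _)" for x
    by (auto simp: inj_def)
  have shift: "pmf (state_at ?\<kappa> n (z, i)) (y, k) = nstep_mat p n (y - z) $ i $ k" for z i y k
    unfolding Suc.IH using pmf_map_inj'[OF inj, of z "state_at ?\<kappa> n (0, i)" "(y - z, k)"]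
    by (simp flip: state_at_translate_origin)
  have "((\<lambda>z. A_mat p z ** nstep_mat p n (y - z)) has_sum
      (\<chi> j k. pmf (state_at ?\<kappa> (Suc n) (0, j)) (y, k))) UNIV"
  proof (intro has_sum_vec)
    fix j k
    let ?f = "\<lambda>(z, i). nstep_mat p n (y - z) $ i $ k"
    have "((\<lambda>s. pmf (?\<kappa> j) s * ?f s) has_sum measure_pmf.expectation (?\<kappa> j) ?f) UNIV"
      using pmf_expectation_has_sum[of ?f 1 "?\<kappa> j"] by (auto simp: Suc.IH pmf_le_1)
    from has_sum_finite_fibres[OF this]
    have "((\<lambda>z. \<Sum>i\<in>UNIV. pmf (?\<kappa> j) (z, i) * ?f (z, i)) has_sum measure_pmf.expectation (?\<kappa> j) ?f) UNIV" by simp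
    also have "(\<lambda>z. \<Sum>i\<in>UNIV. pmf (?\<kappa> j) (z, i) * ?f (z, i)) = (\<lambda>z. (A_mat p z ** nstep_mat p n (y - z)) $ j $ k)"
      by (simp add: matrix_matrix_mult_def A_mat_def pmf_jump_kernel[OF assms])
    also have "measure_pmf.expectation (?\<kappa> j) ?f = pmf (state_at ?\<kappa> (Suc n) (0, j)) (y, k)"
      by (simp add: pmf_bind jump_step_origin case_prod_unfold flip: shift)
    finally show "((\<lambda>z. (A_mat p z ** nstep_mat p n (y - z)) $ j $ k) has_sum
        (\<chi> j k. pmf (state_at ?\<kappa> (Suc n) (0, j)) (y, k)) $ j $ k) UNIV"
      by simp
  qed
  then show ?case by (simp add: infsumI)
qed

lemma group_closure_loop_differences:
  assumes "rw_weights p" "trivial_arithmetic p"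
  shows "group_closure (loop_differences (jump_kernel p) j) = UNIV"
  using assms(2) unfolding trivial_arithmetic_def nstep_mat_eq[OF assms(1)] loop_differences_def by blast

lemma stationary_pmf:
  assumes "rw_weights p" "stationary_distr (Q_mat p) \<mu>"
  obtains \<pi> where "\<And>j. pmf \<pi> j = \<mu> $ j" "bind_pmf \<pi> (\<lambda>j. map_pmf snd (jump_kernel p j)) = \<pi>"
proof -
  have nonneg: "\<mu> $ j \<ge> 0" for j using assms(2) by (simp add: stationary_distr_def)
  have "(\<integral>\<^sup>+j. ennreal (\<mu> $ j) \<partial>count_space UNIV) = ennreal (\<Sum>j\<in>UNIV. \<mu> $ j)"
    using nonneg by (simp add: nn_integral_count_space_finite)
  then have "(\<integral>\<^sup>+j. ennreal (\<mu> $ j) \<partial>count_space UNIV) = 1"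
    using assms(2) by (simp add: stationary_distr_def)
  from pmf_embed_pmf[OF nonneg this] have \<pi>: "pmf (embed_pmf (($) \<mu>)) j = \<mu> $ j" for j by simp
  show thesis
  proof (rule that[OF \<pi>], rule pmf_eqI)
    fix k
    have "pmf (bind_pmf (embed_pmf (($) \<mu>)) (\<lambda>j. map_pmf snd (jump_kernel p j))) k = (\<Sum>j\<in>UNIV. Q_mat p $ j $ k * \<mu> $ j)"
      unfolding pmf_bind Q_mat_eq[OF assms(1)] by (subst integral_measure_pmf_real[of UNIV]) (auto simp: \<pi>)
    also have "\<dots> = (\<mu> v* Q_mat p) $ k"
      by (simp add: vector_matrix_mult_def mult.commute)
    also have "\<dots> = \<mu> $ k" using assms(2) by (simp add: stationary_distr_def)
    finally show "pmf (bind_pmf (embed_pmf (($) \<mu>)) (\<lambda>j. map_pmf snd (jump_kernel p j))) k = pmf (embed_pmf (($) \<mu>)) k"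
      by (simp add: \<pi>)
  qed
qed

text \<open>
  The condition on a process speaks only of histories of positive probability; a history of probability
  zero stays null when it is prolonged.
\<close>

lemma process_cylinder:
  fixes p :: "int ^ 'd \<Rightarrow> 's::finite \<Rightarrow> 's \<Rightarrow> real"
  assumes "rw_weights p" and proc: "rwis_process M p \<xi>"
    and init: "\<And>j. \<P>(\<omega> in M. snd (\<xi> 0 \<omega>) = j) = pmf \<pi> j"
  shows "\<P>(\<omega> in M. \<forall>i\<le>n. \<xi> i \<omega> = w i) = pmf (walk_law (jump_kernel p) \<pi> n) (map w [0..<Suc n])"
proof (induction n)
  interpret prob_space M using proc by (simp add: rwis_process_def)
  have [measurable]: "\<xi> i \<in> measurable M (count_space UNIV)" for i
    using proc by (simp add: rwis_process_def)
  case 0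
  have AE: "AE \<omega> in M. fst (\<xi> 0 \<omega>) = 0" using proc by (simp add: rwis_process_def)
  have ev: "{\<omega> \<in> space M. P (\<xi> 0 \<omega>)} \<in> events" for P
    using measurable_sets[of "\<xi> 0" M "count_space UNIV" "Collect P"] by (simp add: vimage_def Int_def conj_commute)
  have "\<P>(\<omega> in M. \<xi> 0 \<omega> = w 0) = (if fst (w 0) = 0 then pmf \<pi> (snd (w 0)) else 0)"
  proof (cases "fst (w 0) = 0")
    case True
    have "\<P>(\<omega> in M. \<xi> 0 \<omega> = w 0) = \<P>(\<omega> in M. snd (\<xi> 0 \<omega>) = snd (w 0))"
    proof (rule finite_measure_eq_AE)
      show "AE \<omega> in M. \<omega> \<in> {\<omega> \<in> space M. \<xi> 0 \<omega> = w 0} \<longleftrightarrow> \<omega> \<in> {\<omega> \<in> space M. snd (\<xi> 0 \<omega>) = snd (w 0)}"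
        using AE by eventually_elim (auto simp: True prod_eq_iff)
    qed (use ev[of "\<lambda>s. s = w 0"] ev[of "\<lambda>s. snd s = snd (w 0)"] in auto)
    then show ?thesis using True by (simp add: init)
  next
    case False
    have "\<P>(\<omega> in M. \<xi> 0 \<omega> = w 0) = measure M {}"
      using AE False by (intro finite_measure_eq_AE) auto
    then show ?thesis using False by simp
  qed
  moreover have "pmf (walk_law (jump_kernel p) \<pi> 0) [w 0] = (if fst (w 0) = 0 then pmf \<pi> (snd (w 0)) else 0)"
  proof -
    have "walk_law (jump_kernel p) \<pi> 0 = map_pmf (\<lambda>j. [(0, j)]) \<pi>"
      by (simp add: walk_law_def map_pmf_def bind_return_pmf)
    moreover have "inj (\<lambda>j. [(0 :: int ^ 'd, j :: 's)])" by (simp add: inj_def)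
    from pmf_map_inj'[OF this, of \<pi> "snd (w 0)"]
    have "pmf (map_pmf (\<lambda>j. [(0, j)]) \<pi>) [w 0] = pmf \<pi> (snd (w 0))" if "fst (w 0) = 0"
      using that by (metis prod.collapse)
    moreover have "pmf (map_pmf (\<lambda>j. [(0, j)]) \<pi>) [w 0] = 0" if "fst (w 0) \<noteq> 0"
      using that by (auto simp: pmf_eq_0_set_pmf)
    ultimately show ?thesis by simp
  qed
  ultimately show ?case by simp
next
  interpret prob_space M using proc by (simp add: rwis_process_def)
  have [measurable]: "\<xi> i \<in> measurable M (count_space UNIV)" for i
    using proc by (simp add: rwis_process_def)
  case (Suc n)
  let ?A = "\<lambda>\<omega>. \<forall>i\<le>n. \<xi> i \<omega> = w i"
  let ?p = "p (fst (w (Suc n)) - fst (w n)) (snd (w n)) (snd (w (Suc n)))"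
  have split: "(\<forall>i\<le>Suc n. \<xi> i \<omega> = w i) \<longleftrightarrow> \<xi> (Suc n) \<omega> = w (Suc n) \<and> ?A \<omega>" for \<omega>
    by (auto simp: le_Suc_eq)
  have "\<P>(\<omega> in M. \<forall>i\<le>Suc n. \<xi> i \<omega> = w i) = \<P>(\<omega> in M. ?A \<omega>) * ?p"
  proof (cases "\<P>(\<omega> in M. ?A \<omega>) > 0")
    case True
    then have "\<P>(\<omega> in M. \<xi> (Suc n) \<omega> = w (Suc n) \<bar> ?A \<omega>) = ?p"
      using proc unfolding rwis_process_def by blast
    then show ?thesis using True by (simp add: cond_prob_def split field_simps)
  next
    case False
    then have 0: "\<P>(\<omega> in M. ?A \<omega>) = 0" by (simp add: zero_less_measure_iff)
    have "\<P>(\<omega> in M. \<forall>i\<le>Suc n. \<xi> i \<omega> = w i) \<le> \<P>(\<omega> in M. ?A \<omega>)"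
      by (intro finite_measure_mono) (auto simp: split)
    then have "\<P>(\<omega> in M. \<forall>i\<le>Suc n. \<xi> i \<omega> = w i) = 0" unfolding 0 by (simp only: measure_le_0_iff)
    then show ?thesis unfolding 0 by simp
  qed
  also have "\<dots> = pmf (walk_law (jump_kernel p) \<pi> (Suc n)) (map w [0..<Suc n] @ [w (Suc n)])"
    unfolding pmf_walk_law_snoc Suc.IH by (simp add: pmf_jump_step[OF assms(1)])
  finally show ?case by simp
qed

text \<open>
  There are countably many finite paths, so the cylinder probabilities determine the law of the first
  \<open>n + 1\<close> states.
\<close>

lemma expected_visited_eq:
  assumes "rw_weights p" and proc: "rwis_process M p \<xi>"
    and init: "\<And>j. \<P>(\<omega> in M. snd (\<xi> 0 \<omega>) = j) = pmf \<pi> j"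
  shows "expected_visited M \<xi> n = measure_pmf.expectation \<pi> (\<lambda>j. mean_range (jump_kernel p) n (0, j))"
proof -
  interpret prob_space M using proc by (simp add: rwis_process_def)
  have \<xi>[measurable]: "\<xi> i \<in> measurable M (count_space UNIV)" for i
    using proc by (simp add: rwis_process_def)
  define X where "X \<omega> = map (\<lambda>i. \<xi> i \<omega>) [0..<Suc n]" for \<omega>
  have X_eq: "X \<omega> = v \<longleftrightarrow> length v = Suc n \<and> (\<forall>i\<le>n. \<xi> i \<omega> = v ! i)" for \<omega> v
    unfolding X_def list_eq_iff_nth_eq by (auto simp del: upt_Suc simp: less_Suc_eq_le)
  have cyl: "{\<omega> \<in> space M. X \<omega> = v} \<in> sets M" for v
    unfolding X_eq by measurable
  have X[measurable]: "X \<in> measurable M (count_space UNIV)"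
    using cyl by (subst measurable_count_space_eq2_countable) (auto simp: vimage_def Int_def conj_commute)
  have "distr M (count_space UNIV) X = measure_pmf (walk_law (jump_kernel p) \<pi> n)"
  proof (rule measure_eqI_countable)
    fix v
    have "measure M {\<omega> \<in> space M. X \<omega> = v} = pmf (walk_law (jump_kernel p) \<pi> n) v"
    proof (cases "length v = Suc n")
      case True
      then have "map ((!) v) [0..<Suc n] = v" by (metis map_nth)
      then show ?thesis
        using process_cylinder[OF assms, of n "(!) v"] True by (simp add: X_eq del: upt_Suc)
    next
      case False
      then show ?thesis
        using length_walk_law[of v "jump_kernel p" \<pi> n] by (auto simp: X_eq pmf_eq_0_set_pmf)
    qed
    then show "emeasure (distr M (count_space UNIV) X) {v} = emeasure (measure_pmf (walk_law (jump_kernel p) \<pi> n)) {v}"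
      by (simp add: emeasure_distr emeasure_pmf_single emeasure_eq_measure vimage_def Int_def conj_commute)
  qed auto
  moreover have "expected_visited M \<xi> n = integral\<^sup>L (distr M (count_space UNIV) X) (\<lambda>w. real (card (sites w)))"
  proof -
    have "fst ` set (X \<omega>) = (\<lambda>i. fst (\<xi> i \<omega>)) ` {..n}" for \<omega>
      unfolding X_def by (simp add: image_image atLeast0LessThan lessThan_Suc_atMost del: upt_Suc)
    then show ?thesis
      by (simp add: integral_distr expected_visited_def visited_sites_def sites_def)
  qed
  ultimately show ?thesis by (simp add: mean_card_sites_walk_law)
qed

section \<open>Asymptotics of the expected range\<close>

theorem theorem3:
  fixes p :: "int ^ 'd \<Rightarrow> 's::finite \<Rightarrow> 's \<Rightarrow> real"
    and \<mu> :: "real ^ 's"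
    and M :: "'w measure"
    and \<xi> :: "nat \<Rightarrow> 'w \<Rightarrow> (int ^ 'd) \<times> 's"
  assumes dim: "CARD('d) \<ge> 3"
    and weights: "rw_weights p"
    and irreducible: "irreducible_mat (Q_mat p)"
    and aperiodic: "aperiodic_mat (Q_mat p)"
    and stationary: "stationary_distr (Q_mat p) \<mu>"
    and arithmetic: "trivial_arithmetic p"
    and mean: "zero_mean p \<mu>"
    and moments: "second_moments p"
    and nonsingular: "invertible (covariance_mat p \<mu>)"
    and process: "rwis_process M p \<xi>"
    and initial: "\<forall>j. \<P>(\<omega> in M. snd (\<xi> 0 \<omega>) = j) = \<mu> $ j"
  shows "\<exists>\<gamma> \<beta> :: real.
    (CARD('d) = 3 \<longrightarrow>
       (\<lambda>n. expected_visited M \<xi> n - real n * \<gamma>) \<in> O(\<lambda>n. sqrt (real n))) \<and>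
    (CARD('d) = 4 \<longrightarrow>
       (\<lambda>n. expected_visited M \<xi> n - real n * \<gamma>) \<in> O(\<lambda>n. ln (real n))) \<and>
    (CARD('d) \<ge> 5 \<longrightarrow>
       (\<lambda>n. expected_visited M \<xi> n - (real n * \<gamma> + \<beta>))
         \<in> O(\<lambda>n. real n powr (2 - real CARD('d) / 2)))"
proof -
  let ?\<kappa> = "jump_kernel p"
  obtain \<pi> where \<pi>: "\<And>j. pmf \<pi> j = \<mu> $ j" "bind_pmf \<pi> (\<lambda>j. map_pmf snd (?\<kappa> j)) = \<pi>"
    using stationary_pmf[OF weights stationary] by blast
  obtain C where C: "C \<ge> 0" "\<And>n j. n \<ge> 1 \<Longrightarrow>
      measure_pmf.prob (state_at ?\<kappa> n (0, j)) ({0} \<times> UNIV) \<le> C * real n powr (- real CARD('d) / 2)"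
    using return_probability_bound[OF group_closure_loop_differences[OF weights arithmetic]] by blast
  define h where "h m = measure_pmf.expectation \<pi> (no_return ?\<kappa> m)" for m
  have E: "expected_visited M \<xi> n = (\<Sum>m\<le>n. h m)" for n
    unfolding h_def stationary_mean_range[OF \<pi>(2), symmetric]
    using initial \<pi>(1) by (intro expected_visited_eq[OF weights process]) simp
  have int: "integrable (measure_pmf \<pi>) (no_return ?\<kappa> m)" for m
    by (rule integrable_measure_pmf_finite) simp
  have diff: "h m - h (Suc m) = measure_pmf.expectation \<pi> (\<lambda>j. no_return ?\<kappa> m j - no_return ?\<kappa> (Suc m) j)" for m
    unfolding h_def by (rule Bochner_Integration.integral_diff[OF int int, symmetric])
  have "0 \<le> h m - h (Suc m)" for m
    unfolding diff using no_return_Suc(1)[of ?\<kappa> m] by (intro Bochner_Integration.integral_nonneg) simp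
  moreover have "h m - h (Suc m) \<le> C * real (Suc m) powr (- real CARD('d) / 2)" for m
    unfolding diff
  proof (rule measure_pmf.integral_le_const)
    show "AE j in \<pi>. no_return ?\<kappa> m j - no_return ?\<kappa> (Suc m) j \<le> C * real (Suc m) powr (- real CARD('d) / 2)"
      using no_return_Suc(2)[of ?\<kappa> m] C(2)[of "Suc m"] by (intro AE_I2) (auto intro: order_trans)
  qed (intro Bochner_Integration.integrable_diff int)
  ultimately show ?thesis
    unfolding E by (rule sum_asymptotics[OF dim C(1)])
qed

end
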